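(* Let $T$ be a tree on $n\geq 4$ vertices with odd diameter, and let $\xi_n(T)$ denote the least eigenvalue of its eccentricity matrix $\mathcal{E}(T)$. (1) If $4\leq n\leq 15$, then \[\xi_n(T)\leq -\sqrt{\frac{13n-35+\sqrt{(13n-35)^2-64(n-3)}}{2}},\] with equality if and only if $T\cong T_{n,3}^{0,n-4}$. (2) If $n\geq 16$, then \[\xi_n(T)\leq \begin{cases} -\sqrt{\frac{16n-21+\sqrt{800n-1419}}{2}}, & n \text{ odd},\\ -\sqrt{\frac{16n-21+5\sqrt{32n-67}}{2}}, & n\text{ even},\end{cases}\] and each equality holds if and only if $T\cong T_{n,5}^{\lfloor (n-6)/2\rfloor,\lceil (n-6)/2\rceil}$.
   Context: For a connected graph $G$ with distance function $d(u,v)$, the eccentricity of a vertex $u$ is $e(u)=\max_{v}d(u,v)$. The eccentricity matrix $\mathcal{E}(G)$ is the matrix indexed by $V(G)$ with $\mathcal{E}(G)_{uv}=d(u,v)$ if $d(u,v)=\min\{e(u),e(v)\}$, and $\mathcal{E}(G)_{uv}=0$ otherwise. For odd $d\geq 3$ and integers $b\geq a\geq 0$ with $a+b=n-d-1$, $T_{n,d}^{a,b}$ denotes the tree obtained from the path $v_0v_1\cdots v_d$ by attaching $a$ pendant vertices to $v_{(d-1)/2}$ and $b$ pendant vertices to $v_{(d+1)/2}$. *)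

theory Defs
  imports "Graph_Theory.Graph_Theory" "Jordan_Normal_Form.Char_Poly"
begin

text \<open>Finite simple graphs are the symmetric loop-free finite digraphs of locale
  \<open>pair_graph\<close>. In this encoding an edge and its reverse form a directed closed walk of length 2
  that satisfies \<open>cycle\<close>, so \<open>Digraph_Component.tree\<close> is not the undirected notion; the cycles of
  the undirected graph are exactly those of length at least 3.\<close>

definition simple_tree :: "'a pair_pre_digraph \<Rightarrow> bool" where
  "simple_tree G \<longleftrightarrow> pair_graph G \<and> Digraph_Component.connected (with_proj G) \<and>
     \<not> (\<exists>p. pre_digraph.cycle (with_proj G) p \<and> length p \<ge> 3)"

text \<open>On \<^typ>\<open>nat\<close> the infimum of a nonempty set is attained. \<open>gdist\<close> is meant for connected
  graphs only: for vertices without a connecting walk it is the infimum of the empty set,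
  which is 0 on \<^typ>\<open>nat\<close>.\<close>

definition gdist :: "'a pair_pre_digraph \<Rightarrow> 'a \<Rightarrow> 'a \<Rightarrow> nat" where
  "gdist G u v = (INF p \<in> {p. pre_digraph.awalk (with_proj G) u p v}. length p)"

definition eccentricity :: "'a pair_pre_digraph \<Rightarrow> 'a \<Rightarrow> nat" where
  "eccentricity G u = Max (gdist G u ` pverts G)"

definition graph_diameter :: "'a pair_pre_digraph \<Rightarrow> nat" where
  "graph_diameter G = Max (eccentricity G ` pverts G)"

definition ecc_entry :: "'a pair_pre_digraph \<Rightarrow> 'a \<Rightarrow> 'a \<Rightarrow> real" where
  "ecc_entry G u v =
     (if gdist G u v = min (eccentricity G u) (eccentricity G v) then real (gdist G u v) else 0)"

text \<open>The list \<open>vs\<close> is an enumeration of the vertex set without repetition; it fixes the order of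
  the rows and columns.\<close>

definition ecc_mat :: "'a pair_pre_digraph \<Rightarrow> 'a list \<Rightarrow> real mat" where
  "ecc_mat G vs = mat (length vs) (length vs) (\<lambda>(i, j). ecc_entry G (vs ! i) (vs ! j))"

text \<open>For real symmetric matrices such as \<^const>\<open>ecc_mat\<close> all complex eigenvalues are real, so
  only real eigenvalues need to be considered; they form a finite set, nonempty for positive
  dimension.\<close>

definition least_eigenvalue :: "real mat \<Rightarrow> real" where
  "least_eigenvalue A = Min {k. eigenvalue A k}"

text \<open>The tree \<open>T\<^bsub>n,d\<^esub>\<^bsup>a,b\<^esup>\<close>, where \<open>n = d + 1 + a + b\<close>, for odd \<open>d\<close>. The path is \<open>0, \<dots>, d\<close>; the
  numbers from \<open>d + 1\<close> on are the pendant vertices, first those at \<open>(d - 1) / 2\<close>.\<close>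

definition path_with_pendants :: "nat \<Rightarrow> nat \<Rightarrow> nat \<Rightarrow> nat pair_pre_digraph" where
  "path_with_pendants d a b =
     (let E = {(i, Suc i) | i. i < d}
            \<union> {((d - 1) div 2, j) | j. d < j \<and> j \<le> d + a}
            \<union> {((d + 1) div 2, j) | j. d + a < j \<and> j \<le> d + a + b}
      in \<lparr> pverts = {0..d + a + b}, parcs = E \<union> E\<inverse> \<rparr>)"

end

theory Submission
  imports Defs
begin

text \<open>A tree of odd diameter \<open>2 k + 1\<close> has a central edge. Its removal leaves two sides of depth
  \<open>k\<close>, and the eccentricity matrix only has entries between opposite sides, where the entry at
  \<open>u, v\<close> is \<open>d(u, v)\<close> if one of the two is deepest and 0 otherwise. The off-diagonal block therefore
  has rank 2, and the least eigenvalue is \<open>- \<surd>t\<close> for the larger root \<open>t\<close> of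
  \<open>(t - l\<^sub>1 F\<^sub>2) (t - l\<^sub>2 F\<^sub>1) = (2 k + 1)\<^sup>2 l\<^sub>1 l\<^sub>2 t\<close>, where \<open>l\<^sub>i\<close> counts the deepest vertices of
  side \<open>i\<close> and \<open>F\<^sub>i\<close> is the sum of \<open>(depth + k + 1)\<^sup>2\<close> over its other vertices. For \<open>k = 1\<close> the root
  grows with \<open>l\<^sub>1 l\<^sub>2 \<ge> n - 3\<close>. For \<open>k \<ge> 2\<close> it decreases when the weights are lowered to those for
  \<open>k = 2\<close>, then when deepest vertices are turned into vertices of depth 1 until \<open>l\<^sub>1 = l\<^sub>2 = 1\<close>, and
  finally when the two sides are balanced. It remains to compare the two candidates, which change
  places between \<open>n = 15\<close> and \<open>n = 16\<close>.\<close>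

section \<open>Distances and bridges\<close>

text \<open>Roots are never compared as square roots. The larger root of a monic quadratic is at
  least \<open>t\<close> once the quadratic is nonpositive at \<open>t\<close>, so a tree is tested
  by evaluating its own polynomial at the root \<open>t\<close> of a candidate, and each reduction
  only has to move this value in the right direction. A positive value is inconclusive, because a
  \<open>t\<close> far below the larger root can also give one; \<open>below_model\<close> carries
  such cases along. Uniqueness comes from strictness of every reduction away from the candidate.

  The crossover comes from the sizes of the roots. For \<open>k = 1\<close> with a single deepest
  vertex on one side the root is about \<open>13 n\<close>. For the balanced tree of depth 2 the
  root sum, about \<open>16 n\<close>, is shared by two roots of the same order, so the larger one
  is \<open>8 n\<close> plus a multiple of the square root of \<open>n\<close>, which is smaller
  only for large \<open>n\<close>.

  To pass from equal numbers to isomorphic trees, both extremal trees are described by one pattern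
  of eight vertex types, in which the types alone decide adjacency and the class sizes determine the
  graph.\<close>

lemma relpow_sym:
  assumes "sym R" "(u, v) \<in> R ^^ n"
  shows "(v, u) \<in> R ^^ n"
  using assms(2)
proof (induction n arbitrary: v)
  case (Suc n)
  then obtain w where "(u, w) \<in> R ^^ n" "(w, v) \<in> R"
    by auto
  then show ?case
    using Suc.IH assms(1) by (metis relpow_Suc_I2 symD)
qed auto

definition rel_dist :: "'a rel \<Rightarrow> 'a \<Rightarrow> 'a \<Rightarrow> nat" where
  "rel_dist R u v = (LEAST m. (u, v) \<in> R ^^ m)"

lemma rel_dist_le: "(u, v) \<in> R ^^ m \<Longrightarrow> rel_dist R u v \<le> m"
  unfolding rel_dist_def by (rule Least_le)

lemma relpow_rel_dist: "(u, v) \<in> R\<^sup>* \<Longrightarrow> (u, v) \<in> R ^^ rel_dist R u v"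
  unfolding rel_dist_def by (rule LeastI_ex) (simp add: rtrancl_imp_relpow)

lemma rel_dist_triangle:
  assumes "(u, v) \<in> R\<^sup>*" "(v, w) \<in> R\<^sup>*"
  shows "rel_dist R u w \<le> rel_dist R u v + rel_dist R v w"
  using assms by (metis relpow_rel_dist rel_dist_le relpow_trans)

lemma rel_dist_sym: "sym R \<Longrightarrow> rel_dist R u v = rel_dist R v u"
  unfolding rel_dist_def by (metis relpow_sym)

lemma rel_dist_self [simp]: "rel_dist R u u = 0"
  using rel_dist_le[of u u 0 R] by simp

text \<open>Distances are handled through powers of the arc relation, which are easily concatenated
  and reversed. The start vertex must lie in the graph: \<open>awalk\<close> demands this even of
  the empty walk, whereas the zeroth power relates every point to itself.\<close>

lemma (in pair_wf_digraph) awalk_iff_relpow: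
  assumes "u \<in> pverts G"
  shows "(\<exists>p. awalk u p v \<and> length p = m) \<longleftrightarrow> (u, v) \<in> parcs G ^^ m"
  using assms
proof (induction m arbitrary: u)
  case 0
  then show ?case by (auto simp: awalk_Nil_iff)
next
  case (Suc m)
  show ?case
  proof
    assume "\<exists>p. awalk u p v \<and> length p = Suc m"
    then obtain e p where p: "awalk u (e # p) v" "length p = m"
      by (metis length_Suc_conv)
    then have "e \<in> parcs G" "u = fst e" "awalk (snd e) p v"
      by (auto simp: awalk_Cons_iff)
    moreover from this have "(snd e, v) \<in> parcs G ^^ m"
      using Suc.IH p(2) arc_snd_in_verts by blast
    ultimately show "(u, v) \<in> parcs G ^^ Suc m"
      by (metis prod.collapse relpow_Suc_I2)
  next
    assume "(u, v) \<in> parcs G ^^ Suc m"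
    then obtain w where w: "(u, w) \<in> parcs G" "(w, v) \<in> parcs G ^^ m"
      by (meson relpow_Suc_D2)
    then obtain p where "awalk w p v" "length p = m"
      using Suc.IH in_arcsD2 by blast
    then show "\<exists>p. awalk u p v \<and> length p = Suc m"
      using w(1) by (intro exI[of _ "(u, w) # p"]) (simp add: awalk_Cons_iff)
  qed
qed

lemma (in pair_wf_digraph) gdist_eq_rel_dist:
  assumes "u \<in> pverts G"
  shows "gdist G u v = rel_dist (parcs G) u v"
proof -
  have "length ` {p. awalk u p v} = {m. (u, v) \<in> parcs G ^^ m}"
    using awalk_iff_relpow[OF assms, of v] by (auto simp: image_iff) metis
  then show ?thesis
    unfolding gdist_def rel_dist_def by (simp add: Inf_nat_def)
qed

text \<open>A way from \<open>x\<close> to \<open>y\<close> around the edge can be shortened to a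
  path, and the arc \<open>(y, x)\<close> closes it to a cycle. As the path avoids the edge itself,
  it has at least two arcs, so the cycle is long enough to be excluded by
  \<open>simple_tree\<close>.\<close>

lemma simple_tree_bridge:
  assumes tree: "simple_tree T" and xy: "(x, y) \<in> parcs T"
  shows "(x, y) \<notin> (parcs T - {(x, y), (y, x)})\<^sup>*"
proof
  define R where "R = parcs T - {(x, y), (y, x)}"
  define H where "H = \<lparr>pverts = pverts T, parcs = R\<rparr>"
  assume "(x, y) \<in> (parcs T - {(x, y), (y, x)})\<^sup>*"
  then have "(x, y) \<in> R\<^sup>*" by (simp add: R_def)
  interpret T: pair_graph T using tree by (simp add: simple_tree_def)
  interpret H: pair_wf_digraph H
    by unfold_locales (auto simp: H_def R_def dest: T.wellformed')
  have V: "x \<in> pverts T" "y \<in> pverts T" "x \<noteq> y" "(y, x) \<in> parcs T"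
    using xy T.wellformed' T.no_loops' T.arcs_symmetric by blast+
  obtain m where "(x, y) \<in> parcs H ^^ m"
    using \<open>(x, y) \<in> R\<^sup>*\<close> by (auto simp: H_def rtrancl_power)
  then obtain q where "H.awalk x q y"
    using H.awalk_iff_relpow[of x y m] V by (auto simp: H_def)
  then obtain p where p: "H.apath x p y"
    using H.reachable_apath H.reachable_awalk by blast
  have sub: "set p \<subseteq> R" and walk: "T.awalk x p y" and dist: "distinct (pawalk_verts x p)"
    using p unfolding H.apath_def H.awalk_def T.awalk_def by (auto simp: H_def R_def)
  have "length p \<ge> 2"
  proof (rule ccontr)
    assume "\<not> length p \<ge> 2"
    then have "p = [] \<or> (\<exists>e. p = [e])"
      by (cases p rule: list.exhaust; cases "tl p") auto
    then have "(x, y) \<in> R"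
      using walk sub V(3) by (auto simp: T.awalk_Nil_iff T.awalk_Cons_iff)
    then show False by (simp add: R_def)
  qed
  moreover have "T.cycle ((y, x) # p)"
    unfolding T.cycle_def using walk dist V by (auto simp: T.awalk_Cons_iff)
  ultimately show False
    using tree unfolding simple_tree_def
    by (metis One_nat_def Suc_1 Suc_le_mono length_Cons numeral_3_eq_3)
qed

lemma simple_tree_connected:
  assumes tree: "simple_tree T" and "u \<in> pverts T" "v \<in> pverts T"
  shows "(u, v) \<in> (parcs T)\<^sup>*"
proof -
  interpret T: pair_graph T using tree by (simp add: simple_tree_def)
  have "reachable (with_proj T) u v"
    using tree assms(2,3) T.reachable_mk_symmetric_eq[OF T.sym_arcs]
    unfolding simple_tree_def connected_def strongly_connected_def by auto
  then show ?thesis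
    by (auto simp: reachable_def dest: rtrancl_on_rtranclI)
qed

section \<open>Trees with a central edge\<close>

text \<open>The conditions on the labels are local, yet they fix all distances between opposite
  sides. They can be checked for a tree cut at its central edge as well as for a graph known only
  through its vertex types.\<close>

locale bicentral =
  fixes V :: "'a set" and E :: "'a rel"
    and centre :: "bool \<Rightarrow> 'a" and side :: "'a \<Rightarrow> bool" and depth :: "'a \<Rightarrow> nat"
  assumes finite_V: "finite V" and E_sub: "E \<subseteq> V \<times> V" and sym_E: "sym E"
    and centre: "centre s \<in> V" "side (centre s) = s" "depth (centre s) = 0"
    and depth_0: "u \<in> V \<Longrightarrow> depth u = 0 \<Longrightarrow> u = centre (side u)"
    and centres_adjacent: "(centre True, centre False) \<in> E"
    and same_side: "(u, v) \<in> E \<Longrightarrow> side u = side v \<Longrightarrow> depth u \<le> Suc (depth v)"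
    and crossing: "(u, v) \<in> E \<Longrightarrow> side u \<noteq> side v \<Longrightarrow> depth u = 0"
    and parent: "u \<in> V \<Longrightarrow> depth u = Suc j \<Longrightarrow> \<exists>v. (u, v) \<in> E \<and> side v = side u \<and> depth v = j"
begin

lemma walk_to_centre: "u \<in> V \<Longrightarrow> (u, centre (side u)) \<in> E ^^ depth u"
proof (induction "depth u" arbitrary: u)
  case 0
  then have "u = centre (side u)" using depth_0 by metis
  then show ?case using 0 by simp
next
  case (Suc j)
  then obtain v where v: "(u, v) \<in> E" "side v = side u" "depth v = j"
    using parent[of u j] by auto
  then have "(v, centre (side u)) \<in> E ^^ j"
    using Suc.hyps(1)[of v] E_sub by auto
  then show ?case
    using v(1) Suc.hyps(2) by (metis relpow_Suc_I2)
qed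

lemma centres_adjacent': "s \<noteq> t \<Longrightarrow> (centre s, centre t) \<in> E"
  using centres_adjacent symD[OF sym_E centres_adjacent] by (cases s; cases t) auto

text \<open>A potential that changes by at most 1 along an edge, hence a lower bound for distances.
  The sides point in opposite directions, and the summand 1 accounts for the central edge.\<close>

definition height :: "'a \<Rightarrow> int" where
  "height u = (if side u then int (depth u) + 1 else - int (depth u))"

lemma height_edge:
  assumes "(u, v) \<in> E"
  shows "\<bar>height u - height v\<bar> \<le> 1"
proof -
  have "(v, u) \<in> E" using sym_E assms by (rule symD)
  then show ?thesis
    using assms same_side[of u v] same_side[of v u] crossing[of u v] crossing[of v u]
    by (auto simp: height_def)
qed

lemma height_walk: "(u, v) \<in> E ^^ m \<Longrightarrow> \<bar>height u - height v\<bar> \<le> int m"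
proof (induction m arbitrary: v)
  case (Suc m)
  then obtain w where "(u, w) \<in> E ^^ m" "(w, v) \<in> E"
    by auto
  then show ?case
    using Suc.IH[of w] height_edge[of w v] by linarith
qed simp

lemma walk_opposite:
  assumes "u \<in> V" "v \<in> V" "side u \<noteq> side v"
  shows "(u, v) \<in> E ^^ (depth u + (1 + depth v))"
proof -
  have "(centre (side u), centre (side v)) \<in> E ^^ 1"
    using centres_adjacent' assms by simp
  moreover have "(centre (side v), v) \<in> E ^^ depth v"
    by (rule relpow_sym[OF sym_E walk_to_centre[OF assms(2)]])
  ultimately show ?thesis
    using walk_to_centre[OF assms(1)] by (blast intro: relpow_trans)
qed

lemma walk_same:
  assumes "u \<in> V" "v \<in> V" "side u = side v"
  shows "(u, v) \<in> E ^^ (depth u + depth v)"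
proof -
  have "(centre (side v), v) \<in> E ^^ depth v"
    by (rule relpow_sym[OF sym_E walk_to_centre[OF assms(2)]])
  then show ?thesis
    using walk_to_centre[OF assms(1)] assms(3) by (auto intro: relpow_trans)
qed

lemma connected_V: "u \<in> V \<Longrightarrow> v \<in> V \<Longrightarrow> (u, v) \<in> E\<^sup>*"
  using walk_same walk_opposite by (cases "side u = side v") (blast intro: relpow_imp_rtrancl)+

lemma dist_opposite:
  assumes "u \<in> V" "v \<in> V" "side u \<noteq> side v"
  shows "rel_dist E u v = depth u + depth v + 1"
proof -
  have "\<bar>height u - height v\<bar> \<le> int (rel_dist E u v)"
    using assms(1,2) by (intro height_walk relpow_rel_dist connected_V)
  then have "depth u + depth v + 1 \<le> rel_dist E u v"
    using assms(3) by (auto simp: height_def split: if_splits)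
  then show ?thesis
    using rel_dist_le[OF walk_opposite[OF assms]] by linarith
qed

lemma dist_same:
  assumes "u \<in> V" "v \<in> V" "side u = side v"
  shows "rel_dist E u v \<le> depth u + depth v"
  using assms by (intro rel_dist_le walk_same)

end

locale balanced_bicentral = bicentral +
  fixes k :: nat
  assumes depth_le: "u \<in> V \<Longrightarrow> depth u \<le> k"
    and deep: "\<exists>u\<in>V. side u = s \<and> depth u = k"
begin

text \<open>Parents lower the depth by exactly one, so a gap at depth \<open>j\<close> would persist
  at all greater depths, up to \<open>k\<close>.\<close>

lemma depth_attained:
  assumes "j \<le> k"
  shows "\<exists>u\<in>V. side u = s \<and> depth u = j"
proof (rule ccontr)
  assume none: "\<not> ?thesis"
  have "\<forall>u\<in>V. side u = s \<longrightarrow> depth u \<noteq> j + i" for i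
  proof (induction i)
    case (Suc i)
    show ?case
    proof (intro ballI impI notI)
      fix u assume u: "u \<in> V" "side u = s" "depth u = j + Suc i"
      then obtain v where "(u, v) \<in> E" "side v = s" "depth v = j + i"
        using parent[of u "j + i"] by auto
      then show False using Suc.IH E_sub by auto
    qed
  qed (use none in auto)
  from this[of "k - j"] show False
    using assms deep[of s] by auto
qed

text \<open>The lists of class sizes are ordered by side; exchanging the sides supplies the mirrored
  cases.\<close>

lemma flip: "balanced_bicentral V E (\<lambda>s. centre (\<not> s)) (\<lambda>u. \<not> side u) depth k"
proof unfold_locales
  show "finite V" "E \<subseteq> V \<times> V" "sym E" "(centre (\<not> True), centre (\<not> False)) \<in> E"
    using finite_V E_sub sym_E centres_adjacent'[of False True] by auto
  show "\<exists>u\<in>V. (\<not> side u) = s \<and> depth u = k" for s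
    using deep[of "\<not> s"] by auto
  show "\<exists>v. (u, v) \<in> E \<and> (\<not> side v) = (\<not> side u) \<and> depth v = j" if "u \<in> V" "depth u = Suc j" for u j
    using parent[OF that] by auto
  show "u = centre (\<not> \<not> side u)" if "u \<in> V" "depth u = 0" for u
    using depth_0[OF that] by simp
qed (use centre same_side crossing depth_le in auto)

end

text \<open>The central edge is the middle edge of a diametral walk from \<open>a\<close> to
  \<open>b\<close>. Both ends have depth \<open>k\<close>, on opposite sides, so a vertex of greater
  depth would be farther than the diameter from the end on the other side.\<close>

lemma ex_tree_bicentral:
  assumes tree: "simple_tree T" and diam: "graph_diameter T = 2 * k + 1"
  shows "\<exists>centre side depth. balanced_bicentral (pverts T) (parcs T) centre side depth k"
proof -
  let ?V = "pverts T" and ?E = "parcs T"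
  interpret T: pair_graph T using tree by (simp add: simple_tree_def)
  note conn = simple_tree_connected[OF tree]
  have symE: "sym ?E" using T.arcs_symmetric by (auto intro: symI)
  have finV: "finite ?V" by (rule T.pair_finite_verts)
  have E_V: "u \<in> ?V" "v \<in> ?V" if "(u, v) \<in> ?E" for u v
    using that T.wellformed' by auto
  define D where "D = rel_dist ?E"
  have D_gdist: "gdist T u v = D u v" if "u \<in> ?V" for u v
    using T.gdist_eq_rel_dist[OF that] by (simp add: D_def)
  have D_sym: "D u v = D v u" for u v
    unfolding D_def by (rule rel_dist_sym[OF symE])
  have D_tri: "D u w \<le> D u v + D v w" if "u \<in> ?V" "v \<in> ?V" "w \<in> ?V" for u v w
    unfolding D_def using that by (intro rel_dist_triangle conn)
  have D_edge: "D u v \<le> 1" if "(u, v) \<in> ?E" for u v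
    unfolding D_def using that by (intro rel_dist_le) auto
  have D_step: "\<exists>w. (u, w) \<in> ?E \<and> D w v = j" if u: "u \<in> ?V" "v \<in> ?V" "D u v = Suc j" for u v j
  proof -
    have "(u, v) \<in> ?E ^^ Suc j"
      using relpow_rel_dist[OF conn[OF u(1,2)]] u(3) by (simp add: D_def)
    then obtain w where w: "(u, w) \<in> ?E" "(w, v) \<in> ?E ^^ j"
      by (meson relpow_Suc_D2)
    then have "D w v \<le> j" by (simp add: D_def rel_dist_le)
    moreover have "D u v \<le> D u w + D w v" "D u w \<le> 1"
      using D_tri D_edge w(1) E_V u(2) by blast+
    ultimately show ?thesis using u(3) w(1) by (intro exI[of _ w]) simp
  qed
  have D_ecc: "D u v \<le> eccentricity T u" if "u \<in> ?V" "v \<in> ?V" for u v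
    unfolding eccentricity_def using that finV by (auto simp: D_gdist[symmetric])
  have D_max: "D u v \<le> 2 * k + 1" if "u \<in> ?V" "v \<in> ?V" for u v
  proof -
    have "eccentricity T u \<le> graph_diameter T"
      unfolding graph_diameter_def using that finV by (intro Max_ge) auto
    then show ?thesis using D_ecc[OF that] diam by linarith
  qed
  have "?V \<noteq> {}"
    using tree by (auto simp: simple_tree_def connected_def strongly_connected_def)
  then have "graph_diameter T \<in> eccentricity T ` ?V"
    unfolding graph_diameter_def using finV by (intro Max_in) auto
  then obtain a where a: "a \<in> ?V" "eccentricity T a = 2 * k + 1"
    using diam by auto
  have "eccentricity T a \<in> gdist T a ` ?V"
    unfolding eccentricity_def using finV \<open>?V \<noteq> {}\<close> by (intro Max_in) auto
  then obtain b where b: "b \<in> ?V" "D a b = 2 * k + 1"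
    using a D_gdist by auto
  have "(a, b) \<in> ?E ^^ (k + (1 + k))"
    using relpow_rel_dist[OF conn[OF a(1) b(1)]] b(2) by (simp add: D_def mult_2)
  then obtain x where x: "(a, x) \<in> ?E ^^ k" "(x, b) \<in> ?E ^^ Suc k"
    by (auto simp: relpow_add)
  then obtain y where y: "(x, y) \<in> ?E" "(y, b) \<in> ?E ^^ k"
    by (meson relpow_Suc_D2)
  have V: "x \<in> ?V" "y \<in> ?V" using y(1) E_V by auto
  have yx: "(y, x) \<in> ?E" using y(1) symE by (rule symD[rotated])
  have "D a x \<le> k" "D y b \<le> k"
    using x(1) y(2) by (simp_all add: D_def rel_dist_le)
  moreover have "D x y \<le> 1" using D_edge y(1) .
  \<comment> \<open>The pieces of lengths at most \<open>k\<close>, 1 and \<open>k\<close> must add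
    up to at least \<open>2 * k + 1\<close>, so every bound is attained.\<close>
  ultimately have ax: "D a x = k" "D y b = k" "D a y = k + 1" "D x b = k + 1"
    using D_tri[of a x b] D_tri[of a y b] D_tri[of x y b] D_tri[of a x y] a(1) b V by auto

  define R where "R = ?E - {(x, y), (y, x)}"
  have symR: "sym R" using symE by (auto simp: R_def sym_def)
  have bridge: "(x, y) \<notin> R\<^sup>*"
    unfolding R_def by (rule simple_tree_bridge[OF tree y(1)])
  define side where "side u \<longleftrightarrow> (x, u) \<in> R\<^sup>*" for u
  define centre where "centre s = (if s then x else y)" for s
  define depth where "depth u = D (centre (side u)) u" for u
  have side_xy: "side x" "\<not> side y"
    using bridge by (auto simp: side_def)
  have side_cross: "(u, v) = (x, y) \<or> (u, v) = (y, x)" if "(u, v) \<in> ?E" "side u \<noteq> side v" for u v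
  proof (rule ccontr)
    assume "\<not> ?thesis"
    then have "(u, v) \<in> R" "(v, u) \<in> R"
      using that(1) symR by (auto simp: R_def dest: symD)
    then show False
      using that(2) unfolding side_def by (meson rtrancl.rtrancl_into_rtrancl)
  qed
  have centre: "centre s \<in> ?V" "side (centre s) = s" "depth (centre s) = 0" for s
    using V side_xy by (auto simp: centre_def depth_def D_def)
  have depth0: "u = centre (side u)" if "u \<in> ?V" "depth u = 0" for u
    using relpow_rel_dist[OF conn[OF centre(1) that(1)], of "side u"] that(2) by (simp add: depth_def D_def)
  have same: "depth u \<le> Suc (depth v)" if "(u, v) \<in> ?E" "side u = side v" for u v
    using D_tri[of "centre (side v)" v u] D_edge[of u v] D_sym[of u v] E_V[OF that(1)] centre(1)[of "side v"] that
    by (simp add: depth_def)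
  have cross: "depth u = 0" if "(u, v) \<in> ?E" "side u \<noteq> side v" for u v
    using side_cross[OF that] centre(3)[of True] centre(3)[of False] by (auto simp: centre_def)
  have par: "\<exists>v. (u, v) \<in> ?E \<and> side v = side u \<and> depth v = j" if u: "u \<in> ?V" "depth u = Suc j" for u j
  proof -
    obtain w where w: "(u, w) \<in> ?E" "D w (centre (side u)) = j"
      using D_step[OF u(1) centre(1), of "side u"] u(2) D_sym by (auto simp: depth_def)
    \<comment> \<open>An arc that changes sides starts at depth 0, so the first step of a shortest
      walk to the centre stays on its side.\<close>
    moreover have "side w = side u"
      using cross[OF w(1)] u(2) by fastforce
    ultimately show ?thesis
      using D_sym[of w "centre (side u)"] by (intro exI[of _ w]) (simp add: depth_def)
  qed
  interpret DR: bicentral ?V ?E centre side depth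
  proof unfold_locales
    show "(centre True, centre False) \<in> ?E" using y(1) by (simp add: centre_def)
    show "u = centre (side u)" if "u \<in> ?V" "depth u = 0" for u
      using depth0[OF that] .
  qed (use finV E_V symE centre same cross par in auto)
  have opp: "D u v = depth u + depth v + 1" if "u \<in> ?V" "v \<in> ?V" "side u \<noteq> side v" for u v
    using DR.dist_opposite[OF that] by (simp add: D_def)
  have depth_centre: "depth x = 0" "depth y = 0"
    using centre(3)[of True] centre(3)[of False] by (simp_all add: centre_def)
  have "side a"
  proof (rule ccontr)
    assume "\<not> side a"
    \<comment> \<open>From the wrong side \<open>a\<close> would reach \<open>x\<close> only through
      \<open>y\<close>, although \<open>y\<close> is the farther of the two.\<close>
    then have "D a x = D a y + 1"
      using opp[of a x] a(1) V side_xy depth_centre D_sym by (simp add: depth_def centre_def)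
    then show False using ax by simp
  qed
  have "\<not> side b"
  proof
    assume "side b"
    then have "D b y = D b x + 1"
      using opp[of b y] b(1) V side_xy depth_centre D_sym by (simp add: depth_def centre_def)
    then show False using ax D_sym by simp
  qed
  have depths: "depth a = k" "depth b = k"
    using \<open>side a\<close> \<open>\<not> side b\<close> ax D_sym by (simp_all add: depth_def centre_def)
  have "balanced_bicentral ?V ?E centre side depth k"
  proof unfold_locales
    show "depth u \<le> k" if "u \<in> ?V" for u
    proof (cases "side u")
      case True
      then show ?thesis
        using opp[of u b] D_max[of u b] that b(1) \<open>\<not> side b\<close> depths by simp
    next
      case False
      then show ?thesis
        using opp[of u a] D_max[of u a] that a(1) \<open>side a\<close> depths by simp
    qed
    show "\<exists>u\<in>?V. side u = s \<and> depth u = k" for s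
      using a(1) b(1) \<open>side a\<close> \<open>\<not> side b\<close> depths by (cases s) auto
  qed
  then show ?thesis by blast
qed

section \<open>The spectrum of the eccentricity matrix\<close>

text \<open>Vectors become functions on the vertex set, so that the enumeration disappears from the
  spectral argument.\<close>

lemma eigenvalue_matrix_of_function:
  fixes M :: "'a \<Rightarrow> 'a \<Rightarrow> 'b :: field" and vs :: "'a list"
  assumes "distinct vs"
  shows "eigenvalue (mat (length vs) (length vs) (\<lambda>(i, j). M (vs ! i) (vs ! j))) l \<longleftrightarrow>
    (\<exists>x. (\<exists>u\<in>set vs. x u \<noteq> 0) \<and> (\<forall>u\<in>set vs. (\<Sum>v\<in>set vs. M u v * x v) = l * x u))"
    (is "eigenvalue ?A l \<longleftrightarrow> ?R")
proof -
  let ?n = "length vs"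
  have bij: "bij_betw ((!) vs) {0..<?n} (set vs)"
    using assms by (intro bij_betw_nth) auto
  have row: "(?A *\<^sub>v vec ?n (\<lambda>i. x (vs ! i))) $ i = (\<Sum>v\<in>set vs. M (vs ! i) v * x v)"
    if "i < ?n" for x i
    using that by (simp add: scalar_prod_def sum.reindex_bij_betw[OF bij, symmetric])
  have eigen: "?A *\<^sub>v vec ?n (\<lambda>i. x (vs ! i)) = l \<cdot>\<^sub>v vec ?n (\<lambda>i. x (vs ! i)) \<longleftrightarrow>
      (\<forall>u\<in>set vs. (\<Sum>v\<in>set vs. M u v * x v) = l * x u)" for x
  proof -
    have "?A *\<^sub>v vec ?n (\<lambda>i. x (vs ! i)) = l \<cdot>\<^sub>v vec ?n (\<lambda>i. x (vs ! i)) \<longleftrightarrow>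
      (\<forall>i<?n. (\<Sum>v\<in>set vs. M (vs ! i) v * x v) = l * x (vs ! i))"
      by (subst vec_eq_iff) (auto simp: row simp del: index_mult_mat_vec)
    then show ?thesis by (simp add: all_set_conv_all_nth)
  qed
  have nonzero: "vec ?n (\<lambda>i. x (vs ! i)) \<noteq> 0\<^sub>v ?n \<longleftrightarrow> (\<exists>u\<in>set vs. x u \<noteq> 0)" for x
    unfolding vec_eq_iff by (auto simp: in_set_conv_nth Bex_def)
  show ?thesis
  proof
    assume "eigenvalue ?A l"
    then obtain w where w: "w \<in> carrier_vec ?n" "w \<noteq> 0\<^sub>v ?n" "?A *\<^sub>v w = l \<cdot>\<^sub>v w"
      by (auto simp: eigenvalue_def eigenvector_def)
    define x where "x u = w $ (the_inv_into {0..<?n} ((!) vs) u)" for u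
    have "w = vec ?n (\<lambda>i. x (vs ! i))"
      using w(1) bij by (auto simp: x_def vec_eq_iff the_inv_into_f_f bij_betw_def)
    then show ?R
      using w(2,3) eigen[of x] nonzero[of x] by auto
  next
    assume ?R
    then obtain x where "\<exists>u\<in>set vs. x u \<noteq> 0"
        "\<forall>u\<in>set vs. (\<Sum>v\<in>set vs. M u v * x v) = l * x u"
      by blast
    then show "eigenvalue ?A l"
      unfolding eigenvalue_def eigenvector_def using eigen[of x] nonzero[of x]
      by (intro exI[of _ "vec ?n (\<lambda>i. x (vs ! i))"]) auto
  qed
qed

section \<open>The larger root of \<open>t^2 - S * t + P\<close>\<close>

definition larger_root :: "real \<Rightarrow> real \<Rightarrow> real" where
  "larger_root S P = (S + sqrt (S\<^sup>2 - 4 * P)) / 2"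

lemma larger_root_is_root:
  assumes "S\<^sup>2 \<ge> 4 * P"
  shows "(larger_root S P)\<^sup>2 - S * larger_root S P + P = 0"
proof -
  have "(sqrt (S\<^sup>2 - 4 * P))\<^sup>2 = S\<^sup>2 - 4 * P" using assms by simp
  then show ?thesis
    unfolding larger_root_def by (simp add: power2_eq_square field_simps) algebra
qed

text \<open>Completing the square: a nonpositive value at \<open>t\<close> bounds
  \<open>(2 * t - S)^2\<close> by the discriminant. All comparisons of trees rest on this criterion
  and its strict form.\<close>

lemma le_larger_root:
  assumes "t\<^sup>2 - S * t + P \<le> 0"
  shows "t \<le> larger_root S P"
proof -
  have "(2 * t - S)\<^sup>2 \<le> S\<^sup>2 - 4 * P"
    using assms by (simp add: power2_eq_square algebra_simps)
  then have "2 * t - S \<le> sqrt (S\<^sup>2 - 4 * P)"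
    by (metis real_le_rsqrt)
  then show ?thesis by (simp add: larger_root_def)
qed

lemma less_larger_root:
  assumes "t\<^sup>2 - S * t + P < 0"
  shows "t < larger_root S P"
proof -
  have "(2 * t - S)\<^sup>2 < S\<^sup>2 - 4 * P"
    using assms by (simp add: power2_eq_square algebra_simps)
  then have "2 * t - S < sqrt (S\<^sup>2 - 4 * P)"
    by (metis real_less_rsqrt)
  then show ?thesis by (simp add: larger_root_def)
qed

section \<open>Reduction of the eigenvalue equation to two sums per side\<close>

context balanced_bicentral
begin

definition deepest :: "bool \<Rightarrow> 'a set" where
  "deepest s = {u \<in> V. side u = s \<and> depth u = k}"

definition shallow :: "bool \<Rightarrow> 'a set" where
  "shallow s = {u \<in> V. side u = s \<and> depth u \<noteq> k}"

text \<open>This is the eccentricity of \<open>u\<close>, and also its matrix entry with each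
  deepest vertex of the other side.\<close>

definition weight :: "'a \<Rightarrow> real" where
  "weight u = real (depth u + k + 1)"

definition num_deepest :: "bool \<Rightarrow> real" where
  "num_deepest s = real (card (deepest s))"

definition sq_weight :: "bool \<Rightarrow> real" where
  "sq_weight s = (\<Sum>u\<in>shallow s. (weight u)\<^sup>2)"

definition entry :: "'a \<Rightarrow> 'a \<Rightarrow> real" where
  "entry u v = (if side u \<noteq> side v \<and> (depth u = k \<or> depth v = k)
     then real (depth u + depth v + 1) else 0)"

lemma finite_classes [simp]: "finite (deepest s)" "finite (shallow s)"
  using finite_V by (auto simp: deepest_def shallow_def)

lemma num_deepest_ge_1: "num_deepest s \<ge> 1"
proof -
  have "deepest s \<noteq> {}" using deep[of s] by (auto simp: deepest_def)
  then have "card (deepest s) \<noteq> 0" by simp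
  then show ?thesis unfolding num_deepest_def by linarith
qed

lemma V_partition:
  "V = deepest s \<union> shallow s \<union> (deepest (\<not> s) \<union> shallow (\<not> s))"
  by (auto simp: deepest_def shallow_def)

lemma sum_V:
  "(\<Sum>u\<in>V. f u) = (\<Sum>u\<in>deepest s. f u) + (\<Sum>u\<in>shallow s. f u)
     + ((\<Sum>u\<in>deepest (\<not> s). f u) + (\<Sum>u\<in>shallow (\<not> s). f u))" for f :: "'a \<Rightarrow> real"
proof -
  have "(\<Sum>u\<in>V. f u) = (\<Sum>u\<in>deepest s \<union> shallow s. f u)
      + (\<Sum>u\<in>deepest (\<not> s) \<union> shallow (\<not> s). f u)"
    by (subst V_partition[of s], rule sum.union_disjoint) (auto simp: deepest_def shallow_def finite_V)
  moreover have "(\<Sum>u\<in>deepest t \<union> shallow t. f u) = (\<Sum>u\<in>deepest t. f u) + (\<Sum>u\<in>shallow t. f u)" for t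
    by (rule sum.union_disjoint) (auto simp: deepest_def shallow_def finite_V)
  ultimately show ?thesis by simp
qed

text \<open>With deepest vertices of the other side the entry is the weight of \<open>u\<close>.
  Only a deepest \<open>u\<close> has entries with shallow vertices, and these are the weights of
  the latter. So a row sees \<open>x\<close> only through two sums.\<close>

lemma entry_row:
  assumes "u \<in> V"
  shows "(\<Sum>v\<in>V. entry u v * x v) = weight u * (\<Sum>v\<in>deepest (\<not> side u). x v)
     + (if depth u = k then \<Sum>v\<in>shallow (\<not> side u). weight v * x v else 0)"
proof -
  have "(\<Sum>v\<in>deepest (side u). entry u v * x v) = 0" "(\<Sum>v\<in>shallow (side u). entry u v * x v) = 0"
    by (auto intro!: sum.neutral simp: entry_def deepest_def shallow_def)
  moreover have "(\<Sum>v\<in>deepest (\<not> side u). entry u v * x v) = weight u * (\<Sum>v\<in>deepest (\<not> side u). x v)"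
    unfolding sum_distrib_left
    by (intro sum.cong) (auto simp: entry_def deepest_def weight_def)
  moreover have "(\<Sum>v\<in>shallow (\<not> side u). entry u v * x v)
      = (if depth u = k then \<Sum>v\<in>shallow (\<not> side u). weight v * x v else 0)"
    by (auto intro!: sum.cong sum.neutral simp: entry_def shallow_def weight_def algebra_simps)
  ultimately show ?thesis
    by (simp add: sum_V[of _ "side u"])
qed

text \<open>Each row involves the eigenvector only through these sums, so adding the rows with the
  matching coefficients closes the system.\<close>

lemma eigen_sums:
  assumes eigen: "\<And>u. u \<in> V \<Longrightarrow> (\<Sum>v\<in>V. entry u v * x v) = l * x u"
  shows "l * (\<Sum>u\<in>deepest s. x u) = num_deepest s *
      (real (2 * k + 1) * (\<Sum>u\<in>deepest (\<not> s). x u) + (\<Sum>u\<in>shallow (\<not> s). weight u * x u))"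
    and "l * (\<Sum>u\<in>shallow s. weight u * x u) = sq_weight s * (\<Sum>u\<in>deepest (\<not> s). x u)"
proof -
  have row: "l * x u = weight u * (\<Sum>v\<in>deepest (\<not> side u). x v)
     + (if depth u = k then \<Sum>v\<in>shallow (\<not> side u). weight v * x v else 0)" if "u \<in> V" for u
    using eigen[OF that] entry_row[OF that, of x] by simp
  have "l * x u = real (2 * k + 1) * (\<Sum>u\<in>deepest (\<not> s). x u)
      + (\<Sum>u\<in>shallow (\<not> s). weight u * x u)" if "u \<in> deepest s" for u
    using that row[of u] by (simp add: deepest_def weight_def)
  then show "l * (\<Sum>u\<in>deepest s. x u) = num_deepest s *
      (real (2 * k + 1) * (\<Sum>u\<in>deepest (\<not> s). x u) + (\<Sum>u\<in>shallow (\<not> s). weight u * x u))"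
    by (simp add: num_deepest_def sum_distrib_left)
  have "l * x u = weight u * (\<Sum>u\<in>deepest (\<not> s). x u)" if "u \<in> shallow s" for u
    using that row[of u] by (simp add: shallow_def)
  then have "weight u * (l * x u) = (weight u)\<^sup>2 * (\<Sum>u\<in>deepest (\<not> s). x u)" if "u \<in> shallow s" for u
    using that by (simp add: power2_eq_square)
  moreover have "l * (\<Sum>u\<in>shallow s. weight u * x u) = (\<Sum>u\<in>shallow s. weight u * (l * x u))"
    by (simp add: sum_distrib_left algebra_simps)
  ultimately show "l * (\<Sum>u\<in>shallow s. weight u * x u) = sq_weight s * (\<Sum>u\<in>deepest (\<not> s). x u)"
    by (simp add: sq_weight_def sum_distrib_right)
qed

text \<open>The determinant of the two equations for the sums over deepest vertices, after
  elimination of the weighted sums over shallow ones; \<open>t\<close> stands for the squared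
  eigenvalue.\<close>

definition spec_poly :: "real \<Rightarrow> real" where
  "spec_poly t = (t - num_deepest True * sq_weight False) * (t - num_deepest False * sq_weight True)
     - (real (2 * k + 1))\<^sup>2 * num_deepest True * num_deepest False * t"

lemma eigenvector_imp_spec_poly:
  assumes eigen: "\<And>u. u \<in> V \<Longrightarrow> (\<Sum>v\<in>V. entry u v * x v) = l * x u"
    and nonzero: "\<exists>u\<in>V. x u \<noteq> 0" and "l \<noteq> 0"
  shows "spec_poly (l\<^sup>2) = 0"
proof -
  define X where "X s = (\<Sum>u\<in>deepest s. x u)" for s
  define Y where "Y s = (\<Sum>u\<in>shallow s. weight u * x u)" for s
  define d where "d = real (2 * k + 1)"
  have X: "l * X s = num_deepest s * (d * X (\<not> s) + Y (\<not> s))" for s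
    unfolding X_def Y_def d_def by (rule eigen_sums(1)[OF eigen])
  have Y: "l * Y s = sq_weight s * X (\<not> s)" for s
    unfolding X_def Y_def by (rule eigen_sums(2)[OF eigen])
  have key: "(l\<^sup>2 - num_deepest s * sq_weight (\<not> s)) * X s = num_deepest s * d * l * X (\<not> s)" for s
  proof -
    have "l * (l * X s) = num_deepest s * (d * l * X (\<not> s) + l * Y (\<not> s))"
      using X[of s] by (simp add: algebra_simps)
    then show ?thesis using Y[of "\<not> s"] by (simp add: algebra_simps power2_eq_square)
  qed
  \<comment> \<open>If one of these sums vanished, so would the other, then both weighted sums, and
    with them all rows.\<close>
  have "X s \<noteq> 0" for s
  proof
    assume "X s = 0"
    then have "X (\<not> s) = 0"
      using key[of s] num_deepest_ge_1[of s] \<open>l \<noteq> 0\<close> by (simp add: d_def)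
    then have "X t = 0" for t
      using \<open>X s = 0\<close> by (cases t; cases s) auto
    moreover from this have "Y t = 0" for t
      using Y[of t] \<open>l \<noteq> 0\<close> by simp
    ultimately have "l * x u = 0" if "u \<in> V" for u
      using eigen[OF that] entry_row[OF that, of x] by (simp add: X_def Y_def split: if_splits)
    then show False using nonzero \<open>l \<noteq> 0\<close> by auto
  qed
  then have "X True * X False \<noteq> 0" by simp
  moreover have "X True * X False * spec_poly (l\<^sup>2) = 0"
  proof -
    have "((l\<^sup>2 - num_deepest True * sq_weight False) * X True) * ((l\<^sup>2 - num_deepest False * sq_weight True) * X False)
      = (num_deepest True * d * l * X False) * (num_deepest False * d * l * X True)"
      using key[of True] key[of False] by simp
    then show ?thesis
      unfolding spec_poly_def d_def[symmetric] by (simp add: power2_eq_square algebra_simps)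
  qed
  ultimately show ?thesis by simp
qed

lemma spec_poly_imp_eigenvector:
  assumes zero: "spec_poly (l\<^sup>2) = 0" and "l \<noteq> 0"
  shows "\<exists>x. (\<exists>u\<in>V. x u \<noteq> 0) \<and> (\<forall>u\<in>V. (\<Sum>v\<in>V. entry u v * x v) = l * x u)"
proof -
  define d where "d = real (2 * k + 1)"
  \<comment> \<open>A kernel vector of the singular two-by-two system in \<open>key\<close>: the
    equation for \<open>True\<close> holds identically, and the one for \<open>False\<close> is
    \<open>zero\<close>. The vector \<open>x\<close> is then forced by the rows.\<close>
  define X where "X s = (if s then num_deepest True * d * l
     else l\<^sup>2 - num_deepest True * sq_weight False)" for s
  define Y where "Y s = sq_weight s * X (\<not> s) / l" for s
  define x where "x u = (weight u * X (\<not> side u) + (if depth u = k then Y (\<not> side u) else 0)) / l" for u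
  have key: "(l\<^sup>2 - num_deepest s * sq_weight (\<not> s)) * X s = num_deepest s * d * l * X (\<not> s)" for s
    using zero unfolding spec_poly_def d_def[symmetric]
    by (cases s) (auto simp: X_def algebra_simps power2_eq_square)
  have sum_X: "(\<Sum>u\<in>deepest s. x u) = X s" for s
  proof -
    have "(\<Sum>u\<in>deepest s. x u) = (\<Sum>u\<in>deepest s. (d * X (\<not> s) + Y (\<not> s)) / l)"
      by (intro sum.cong) (auto simp: x_def deepest_def weight_def d_def)
    also have "\<dots> = num_deepest s * (d * X (\<not> s) + Y (\<not> s)) / l"
      by (simp add: num_deepest_def)
    also have "\<dots> = X s"
      using key[of s] \<open>l \<noteq> 0\<close> by (simp add: Y_def field_simps power2_eq_square)
    finally show ?thesis .
  qed
  have sum_Y: "(\<Sum>u\<in>shallow s. weight u * x u) = Y s" for s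
  proof -
    have "(\<Sum>u\<in>shallow s. weight u * x u) = (\<Sum>u\<in>shallow s. (weight u)\<^sup>2 * (X (\<not> s) / l))"
      by (intro sum.cong) (auto simp: x_def shallow_def power2_eq_square)
    also have "\<dots> = Y s"
      unfolding sum_distrib_right[symmetric] by (simp add: Y_def sq_weight_def)
    finally show ?thesis .
  qed
  have "X True \<noteq> 0"
    using num_deepest_ge_1[of True] \<open>l \<noteq> 0\<close> by (simp add: X_def d_def)
  then have "\<exists>u\<in>deepest True. x u \<noteq> 0"
    unfolding sum_X[symmetric] by (meson sum.neutral)
  then have "\<exists>u\<in>V. x u \<noteq> 0" by (auto simp: deepest_def)
  moreover have "\<forall>u\<in>V. (\<Sum>v\<in>V. entry u v * x v) = l * x u"
  proof
    fix u assume "u \<in> V"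
    then show "(\<Sum>v\<in>V. entry u v * x v) = l * x u"
      using \<open>l \<noteq> 0\<close> by (simp only: entry_row sum_X sum_Y) (simp add: x_def)
  qed
  ultimately show ?thesis by blast
qed

definition spec_trace :: real where
  "spec_trace = (real (2 * k + 1))\<^sup>2 * num_deepest True * num_deepest False
     + num_deepest True * sq_weight False + num_deepest False * sq_weight True"

definition spec_det :: real where
  "spec_det = num_deepest True * num_deepest False * sq_weight True * sq_weight False"

lemma spec_poly_eq: "spec_poly t = t\<^sup>2 - spec_trace * t + spec_det"
  by (simp add: spec_poly_def spec_trace_def spec_det_def power2_eq_square algebra_simps)

lemma sq_weight_nonneg: "sq_weight s \<ge> 0"
  unfolding sq_weight_def by (intro sum_nonneg) auto

lemma spec_discriminant: "spec_trace\<^sup>2 \<ge> 4 * spec_det" and spec_trace_pos: "spec_trace > 0"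
proof -
  define a b c where "a = num_deepest True * sq_weight False"
    and "b = num_deepest False * sq_weight True"
    and "c = (real (2 * k + 1))\<^sup>2 * num_deepest True * num_deepest False"
  have nn: "a \<ge> 0" "b \<ge> 0"
    using num_deepest_ge_1[of True] num_deepest_ge_1[of False] sq_weight_nonneg
    by (auto simp: a_def b_def)
  have c: "c > 0"
    using num_deepest_ge_1[of True] num_deepest_ge_1[of False] by (simp add: c_def)
  have eq: "spec_trace = c + a + b" "spec_det = a * b"
    by (simp_all add: spec_trace_def spec_det_def a_def b_def c_def)
  show "spec_trace > 0" using nn c eq by simp
  have "4 * (a * b) \<le> (a + b)\<^sup>2"
    using zero_le_power2[of "a - b"] by (simp add: power2_eq_square algebra_simps)
  also have "\<dots> \<le> (c + a + b)\<^sup>2" using nn c by (intro power_mono) auto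
  finally show "spec_trace\<^sup>2 \<ge> 4 * spec_det" using eq by simp
qed

text \<open>The nonzero eigenvalues are the \<open>l\<close> whose square is a root of
  \<open>spec_poly\<close>. They occur in pairs of opposite sign, so the least one is the negative
  square root of the larger root.\<close>

lemma least_eigenvalue_entry:
  assumes vs: "distinct vs" "set vs = V"
  shows "least_eigenvalue (mat (length vs) (length vs) (\<lambda>(i, j). entry (vs ! i) (vs ! j)))
     = - sqrt (larger_root spec_trace spec_det)"
proof -
  let ?A = "mat (length vs) (length vs) (\<lambda>(i, j). entry (vs ! i) (vs ! j))"
  define r where "r = larger_root spec_trace spec_det"
  have "r > 0"
    unfolding r_def larger_root_def
    using spec_trace_pos spec_discriminant by (intro divide_pos_pos add_pos_nonneg) auto
  have "spec_poly r = 0"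
    unfolding r_def spec_poly_eq by (rule larger_root_is_root[OF spec_discriminant])
  then have "eigenvalue ?A (- sqrt r)"
    using spec_poly_imp_eigenvector[of "- sqrt r"] \<open>r > 0\<close>
    unfolding eigenvalue_matrix_of_function[OF vs(1)] vs(2) by simp
  moreover have "- sqrt r \<le> l" if "eigenvalue ?A l" for l
  proof (cases "l = 0")
    case False
    have "spec_poly (l\<^sup>2) = 0"
      using that eigenvector_imp_spec_poly[OF _ _ False]
      unfolding eigenvalue_matrix_of_function[OF vs(1)] vs(2) by blast
    then have "l\<^sup>2 \<le> r"
      unfolding r_def spec_poly_eq by (intro le_larger_root) simp
    then have "\<bar>l\<bar> \<le> sqrt r"
      by (rule real_le_rsqrt[of "\<bar>l\<bar>", simplified])
    then show ?thesis by simp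
  qed (use \<open>r > 0\<close> in simp)
  \<comment> \<open>\<open>Min\<close> needs a finite set of eigenvalues.\<close>
  moreover have "finite {l. eigenvalue ?A l}"
  proof -
    have A: "?A \<in> carrier_mat (length vs) (length vs)" by simp
    have "char_poly ?A \<noteq> 0"
      using degree_monic_char_poly[OF A] by auto
    then show ?thesis
      unfolding eigenvalue_root_char_poly[OF A] by (rule poly_roots_finite)
  qed
  ultimately show ?thesis
    unfolding least_eigenvalue_def r_def[symmetric] by (intro Min_eqI) auto
qed

end

text \<open>A farthest vertex is always a deepest one across the central edge. On opposite sides the
  distance therefore equals the smaller eccentricity exactly when one depth is \<open>k\<close>; on
  the same side it stays below both.\<close>

lemma least_eigenvalue_ecc_mat:
  assumes graph: "pair_wf_digraph T"
    and "balanced_bicentral (pverts T) (parcs T) centre side depth k"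
    and vs: "distinct vs" "set vs = pverts T"
  shows "least_eigenvalue (ecc_mat T vs) = - sqrt (larger_root
      (balanced_bicentral.spec_trace (pverts T) side depth k)
      (balanced_bicentral.spec_det (pverts T) side depth k))"
proof -
  interpret T: pair_wf_digraph T by fact
  interpret balanced_bicentral "pverts T" "parcs T" centre side depth k by fact
  have opp: "gdist T u v = depth u + depth v + 1"
    if "u \<in> pverts T" "v \<in> pverts T" "side u \<noteq> side v" for u v
    using that dist_opposite by (simp add: T.gdist_eq_rel_dist)
  have same: "gdist T u v \<le> depth u + depth v"
    if "u \<in> pverts T" "v \<in> pverts T" "side u = side v" for u v
    using that dist_same by (simp add: T.gdist_eq_rel_dist)
  have ecc: "eccentricity T u = depth u + k + 1" if u: "u \<in> pverts T" for u
    unfolding eccentricity_def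
  proof (intro Max_eqI)
    show "n \<le> depth u + k + 1" if "n \<in> gdist T u ` pverts T" for n
    proof -
      obtain v where v: "v \<in> pverts T" "n = gdist T u v" using \<open>n \<in> _\<close> by auto
      then show ?thesis
        using opp[OF u v(1)] same[OF u v(1)] depth_le[OF v(1)] by (cases "side u = side v") auto
    qed
    obtain w where w: "w \<in> pverts T" "side w = (\<not> side u)" "depth w = k"
      using deep by blast
    then have "gdist T u w = depth u + k + 1" using opp[OF u w(1)] by simp
    then show "depth u + k + 1 \<in> gdist T u ` pverts T" using w(1) by (metis imageI)
  qed (use finite_V in simp)
  have "ecc_entry T u v = entry u v" if uv: "u \<in> pverts T" "v \<in> pverts T" for u v
  proof (cases "side u = side v")
    case True
    then have "gdist T u v < min (eccentricity T u) (eccentricity T v)"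
      using same[OF uv True] depth_le[OF uv(1)] depth_le[OF uv(2)] by (simp add: ecc uv)
    then show ?thesis using True unfolding ecc_entry_def entry_def by (metis less_irrefl)
  next
    case False
    then show ?thesis
      using opp[OF uv False] depth_le[OF uv(1)] depth_le[OF uv(2)]
      by (auto simp: ecc_entry_def entry_def ecc uv)
  qed
  then have "ecc_mat T vs = mat (length vs) (length vs) (\<lambda>(i, j). entry (vs ! i) (vs ! j))"
    unfolding ecc_mat_def using vs(2) by (intro cong_mat) (auto dest: nth_mem)
  then show ?thesis using least_eigenvalue_entry[OF vs] by simp
qed

section \<open>Isomorphism via vertex types\<close>

text \<open>An isomorphism of digraphs also carries a map on arcs and new head and tail functions.
  For pair digraphs these are forced by the vertex map, as an arc is the pair of its ends.\<close>

lemma digraph_iso_with_proj_iff: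
  assumes "pair_wf_digraph G" "pair_wf_digraph H"
  shows "digraph_iso (with_proj G) (with_proj H) \<longleftrightarrow>
    (\<exists>f. bij_betw f (pverts G) (pverts H) \<and>
      (\<forall>u\<in>pverts G. \<forall>v\<in>pverts G. (u, v) \<in> parcs G \<longleftrightarrow> (f u, f v) \<in> parcs H))"
proof
  interpret G: pair_wf_digraph G by fact
  assume "digraph_iso (with_proj G) (with_proj H)"
  then obtain h where h: "G.digraph_isomorphism h" "with_proj H = app_iso h (with_proj G)"
    by (auto simp: digraph_iso_def)
  define f where "f = iso_verts h"
  have proj: "iso_tail h = fst" "iso_head h = snd" "pverts H = f ` pverts G"
      "parcs H = iso_arcs h ` parcs G"
    using arg_cong[OF h(2), of tail] arg_cong[OF h(2), of head] arg_cong[OF h(2), of verts]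
      arg_cong[OF h(2), of arcs] by (simp_all add: f_def)
  have inj: "inj_on f (pverts G)"
    using h(1) by (simp add: G.digraph_isomorphism_def f_def)
  have arc: "iso_arcs h a = (f (fst a), f (snd a))" if "a \<in> parcs G" for a
    using h(1) that proj(1,2) unfolding G.digraph_isomorphism_def f_def
    by (metis prod.collapse)
  have "(u, v) \<in> parcs G \<longleftrightarrow> (f u, f v) \<in> parcs H" if uv: "u \<in> pverts G" "v \<in> pverts G" for u v
  proof
    assume "(f u, f v) \<in> parcs H"
    then obtain a where a: "a \<in> parcs G" "f u = f (fst a)" "f v = f (snd a)"
      using proj(4) arc by force
    then have "u = fst a" "v = snd a"
      using inj uv G.arc_fst_in_verts G.arc_snd_in_verts by (auto dest: inj_onD)
    then show "(u, v) \<in> parcs G" using a(1) by simp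
  qed (use arc proj(4) in force)
  then show "\<exists>f. bij_betw f (pverts G) (pverts H) \<and>
      (\<forall>u\<in>pverts G. \<forall>v\<in>pverts G. (u, v) \<in> parcs G \<longleftrightarrow> (f u, f v) \<in> parcs H)"
    using inj proj(3) by (intro exI[of _ f]) (auto simp: bij_betw_def)
next
  interpret G: pair_wf_digraph G by fact
  interpret H: pair_wf_digraph H by fact
  assume "\<exists>f. bij_betw f (pverts G) (pverts H) \<and>
      (\<forall>u\<in>pverts G. \<forall>v\<in>pverts G. (u, v) \<in> parcs G \<longleftrightarrow> (f u, f v) \<in> parcs H)"
  then obtain f where f: "bij_betw f (pverts G) (pverts H)"
      and arcs: "\<And>u v. u \<in> pverts G \<Longrightarrow> v \<in> pverts G \<Longrightarrow> (u, v) \<in> parcs G \<longleftrightarrow> (f u, f v) \<in> parcs H"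
    by blast
  have inj: "inj_on f (pverts G)" and img: "f ` pverts G = pverts H"
    using f by (simp_all add: bij_betw_def)
  define h where "h = \<lparr>iso_verts = f, iso_arcs = map_prod f f, iso_head = snd, iso_tail = fst\<rparr>"
  have sub: "parcs G \<subseteq> pverts G \<times> pverts G"
    using G.wellformed' by auto
  have "inj_on (map_prod f f) (parcs G)"
    using inj_on_subset[OF map_prod_inj_on[OF inj inj] sub] .
  then have "G.digraph_isomorphism h"
    unfolding G.digraph_isomorphism_def using inj G.wf_digraph_axioms by (simp add: h_def)
  moreover have "parcs H = map_prod f f ` parcs G"
  proof (intro equalityI subsetI)
    fix a assume "a \<in> parcs H"
    then obtain u v where "a = (f u, f v)" "u \<in> pverts G" "v \<in> pverts G"
      using H.arc_fst_in_verts H.arc_snd_in_verts img by (metis imageE prod.collapse)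
    then show "a \<in> map_prod f f ` parcs G"
      using arcs \<open>a \<in> parcs H\<close> by (intro image_eqI[of _ _ "(u, v)"]) auto
  next
    fix a assume "a \<in> map_prod f f ` parcs G"
    then obtain u v where "a = (f u, f v)" "(u, v) \<in> parcs G" by auto
    then show "a \<in> parcs H" using arcs[of u v] sub by blast
  qed
  then have "with_proj H = app_iso h (with_proj G)"
    using img by (simp add: app_iso_def h_def with_proj_def)
  ultimately show "digraph_iso (with_proj G) (with_proj H)"
    by (auto simp: digraph_iso_def)
qed

text \<open>Parity encodes the side: exchanging \<open>2 * i\<close> and \<open>2 * i + 1\<close> is
  a symmetry of the pattern.\<close>

definition type_adj :: "nat \<Rightarrow> nat \<Rightarrow> bool" where
  "type_adj i j \<longleftrightarrow> (i, j) \<in> {(0, 1), (0, 2), (1, 3), (0, 4), (1, 5), (4, 6), (5, 7)}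
     \<or> (j, i) \<in> {(0, 1), (0, 2), (1, 3), (0, 4), (1, 5), (4, 6), (5, 7)}"

text \<open>The types 0 and 1 are the two central vertices. The types 2 and 3 are leaves attached to
  them, and the types 4 and 5 are neighbours of the centres that carry leaves of types 6 and 7.\<close>

definition typed :: "'a pair_pre_digraph \<Rightarrow> ('a \<Rightarrow> nat) \<Rightarrow> nat list \<Rightarrow> bool" where
  "typed G ty ns \<longleftrightarrow> length ns = 8 \<and> (\<forall>u\<in>pverts G. ty u < 8)
     \<and> (\<forall>i<8. finite {u \<in> pverts G. ty u = i} \<and> card {u \<in> pverts G. ty u = i} = ns ! i)
     \<and> (\<forall>u\<in>pverts G. \<forall>v\<in>pverts G. (u, v) \<in> parcs G \<longleftrightarrow> type_adj (ty u) (ty v))"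

lemma ex_bij_betw_fibres:
  assumes "\<And>u. u \<in> A \<Longrightarrow> f u \<in> I" "\<And>v. v \<in> B \<Longrightarrow> g v \<in> I"
    and fin: "\<And>i. i \<in> I \<Longrightarrow> finite {u \<in> A. f u = i}" "\<And>i. i \<in> I \<Longrightarrow> finite {v \<in> B. g v = i}"
    and card: "\<And>i. i \<in> I \<Longrightarrow> card {u \<in> A. f u = i} = card {v \<in> B. g v = i}"
  shows "\<exists>h. bij_betw h A B \<and> (\<forall>u\<in>A. g (h u) = f u)"
proof -
  have "\<forall>i\<in>I. \<exists>h. bij_betw h {u \<in> A. f u = i} {v \<in> B. g v = i}"
    using fin card by (auto intro: finite_same_card_bij)
  then obtain h where h: "\<And>i. i \<in> I \<Longrightarrow> bij_betw (h i) {u \<in> A. f u = i} {v \<in> B. g v = i}"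
    by metis
  define H where "H u = h (f u) u" for u
  have mem: "H u \<in> B" "g (H u) = f u" if "u \<in> A" for u
    using bij_betw_apply[OF h[OF assms(1)[OF that]], of u] that by (auto simp: H_def)
  have "inj_on H A"
  proof (intro inj_onI)
    fix u v assume uv: "u \<in> A" "v \<in> A" "H u = H v"
    then have eq: "f u = f v" using mem by metis
    have "inj_on (h (f v)) {w \<in> A. f w = f v}"
      using h[OF assms(1)[OF uv(2)]] by (simp add: bij_betw_def)
    then show "u = v"
      using uv eq by (auto simp: H_def dest: inj_onD)
  qed
  moreover have "B \<subseteq> H ` A"
  proof
    fix v assume "v \<in> B"
    then have "v \<in> h (g v) ` {u \<in> A. f u = g v}"
      using h[OF assms(2)] by (auto simp: bij_betw_def)
    then obtain u where "u \<in> A" "f u = g v" "v = h (g v) u" by auto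
    then show "v \<in> H ` A" by (intro image_eqI[of _ _ u]) (simp_all add: H_def)
  qed
  ultimately have "bij_betw H A B" using mem by (auto simp: bij_betw_def)
  then show ?thesis using mem by blast
qed

text \<open>Adjacency depends on types only, so every bijection that respects the types is an
  isomorphism, and equal class sizes provide one.\<close>

lemma typed_imp_iso:
  assumes "pair_wf_digraph G" "pair_wf_digraph H" "typed G ty ns" "typed H ty' ns"
  shows "digraph_iso (with_proj G) (with_proj H)"
proof -
  obtain f where f: "bij_betw f (pverts G) (pverts H)" "\<forall>u\<in>pverts G. ty' (f u) = ty u"
    using ex_bij_betw_fibres[of "pverts G" ty "{..<8}" "pverts H" ty'] assms(3,4)
    by (auto simp: typed_def)
  then have "f u \<in> pverts H" if "u \<in> pverts G" for u
    using that by (auto dest: bij_betwE)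
  then show ?thesis
    unfolding digraph_iso_with_proj_iff[OF assms(1,2)] using f assms(3,4)
    by (intro exI[of _ f]) (simp add: typed_def)
qed

lemma iso_imp_typed:
  assumes "pair_wf_digraph G" "pair_wf_digraph H" "typed H ty ns"
    and "digraph_iso (with_proj G) (with_proj H)"
  shows "\<exists>ty'. typed G ty' ns"
proof -
  obtain f where f: "bij_betw f (pverts G) (pverts H)"
      "\<forall>u\<in>pverts G. \<forall>v\<in>pverts G. (u, v) \<in> parcs G \<longleftrightarrow> (f u, f v) \<in> parcs H"
    using assms(4) unfolding digraph_iso_with_proj_iff[OF assms(1,2)] by blast
  have mem: "f u \<in> pverts H" if "u \<in> pverts G" for u
    using that f(1) by (auto dest: bij_betwE)
  have "bij_betw f {u \<in> pverts G. ty (f u) = i} {v \<in> pverts H. ty v = i}" for i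
    using f(1) unfolding bij_betw_def by (auto simp: inj_on_def)
  then have "finite {u \<in> pverts G. ty (f u) = i} \<longleftrightarrow> finite {v \<in> pverts H. ty v = i}"
      "card {u \<in> pverts G. ty (f u) = i} = card {v \<in> pverts H. ty v = i}" for i
    using bij_betw_finite bij_betw_same_card by blast+
  then have "typed G (ty \<circ> f) ns"
    using assms(3) f(2) mem by (simp add: typed_def)
  then show ?thesis by blast
qed

section \<open>Types in the two extremal trees\<close>

definition type3 :: "nat \<Rightarrow> nat" where
  "type3 v = (if v = 0 then 2 else if v = 1 then 0 else if v = 2 then 1 else 3)"

definition type5 :: "nat \<Rightarrow> nat \<Rightarrow> nat" where
  "type5 a v = (if v < 6 then [6, 4, 0, 1, 5, 7] ! v else if v \<le> 5 + a then 2 else 3)"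

lemma wf_path_with_pendants: "pair_wf_digraph (path_with_pendants d a b)"
  by unfold_locales (auto simp: path_with_pendants_def Let_def)

lemma less_8_iff: "i < (8::nat) \<longleftrightarrow> i \<in> {0, 1, 2, 3, 4, 5, 6, 7}"
  by auto

text \<open>The path end 3 is a leaf at 2 just like the \<open>b\<close> pendant vertices, whence
  \<open>b + 1\<close>.\<close>

lemma typed_path3: "typed (path_with_pendants 3 0 b) type3 [1, 1, 1, b + 1, 0, 0, 0, 0]"
proof -
  have V: "pverts (path_with_pendants 3 0 b) = {0..3 + b}"
    by (simp add: path_with_pendants_def Let_def)
  have fibres: "{u \<in> {0..3 + b}. type3 u = 0} = {1}" "{u \<in> {0..3 + b}. type3 u = 1} = {2}"
      "{u \<in> {0..3 + b}. type3 u = 2} = {0}" "{u \<in> {0..3 + b}. type3 u = 3} = {3..3 + b}"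
      "{u \<in> {0..3 + b}. type3 u = 4} = {}" "{u \<in> {0..3 + b}. type3 u = 5} = {}"
      "{u \<in> {0..3 + b}. type3 u = 6} = {}" "{u \<in> {0..3 + b}. type3 u = 7} = {}"
    by (auto simp: type3_def split: if_splits)
  have arcs: "(u, v) \<in> parcs (path_with_pendants 3 0 b) \<longleftrightarrow>
      (\<exists>i<3. (u = i \<and> v = Suc i) \<or> (v = i \<and> u = Suc i))
      \<or> (u = 2 \<and> 3 < v \<and> v \<le> 3 + b) \<or> (v = 2 \<and> 3 < u \<and> u \<le> 3 + b)" for u v
    by (auto simp: path_with_pendants_def Let_def)
  show ?thesis
    unfolding typed_def V arcs
  proof (intro conjI ballI allI impI)
    show "finite {u \<in> {0..3 + b}. type3 u = i}" for i by simp
    show "card {u \<in> {0..3 + b}. type3 u = i} = [1, 1, 1, b + 1, 0, 0, 0, 0] ! i" if "i < 8" for i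
      using that unfolding less_8_iff by (elim insertE emptyE; hypsubst; simp only: fibres; simp)
  next
    fix u v assume uv: "u \<in> {0..3 + b}" "v \<in> {0..3 + b}"
    show "((\<exists>i<3. (u = i \<and> v = Suc i) \<or> (v = i \<and> u = Suc i))
      \<or> (u = 2 \<and> 3 < v \<and> v \<le> 3 + b) \<or> (v = 2 \<and> 3 < u \<and> u \<le> 3 + b)) = type_adj (type3 u) (type3 v)"
      using uv unfolding type_adj_def type3_def
      by (auto simp: numeral_3_eq_3 less_Suc_eq)
  qed (auto simp: type3_def)
qed

lemma typed_path5: "typed (path_with_pendants 5 a b) (type5 a) [1, 1, a, b, 1, 1, 1, 1]"
proof -
  have V: "pverts (path_with_pendants 5 a b) = {0..5 + a + b}"
    by (simp add: path_with_pendants_def Let_def)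
  have lt6: "u < 6 \<longleftrightarrow> u = 0 \<or> u = 1 \<or> u = 2 \<or> u = 3 \<or> u = 4 \<or> u = 5" for u :: nat
    by auto
  have type5: "type5 a u = (if u = 0 then 6 else if u = 1 then 4 else if u = 2 then 0 else
      if u = 3 then 1 else if u = 4 then 5 else if u = 5 then 7 else
      if u \<le> 5 + a then 2 else 3)" for u
    by (auto simp: type5_def lt6)
  have fibres: "{u \<in> {0..5 + a + b}. type5 a u = 0} = {2}" "{u \<in> {0..5 + a + b}. type5 a u = 1} = {3}"
      "{u \<in> {0..5 + a + b}. type5 a u = 2} = {6..5 + a}"
      "{u \<in> {0..5 + a + b}. type5 a u = 3} = {6 + a..5 + a + b}"
      "{u \<in> {0..5 + a + b}. type5 a u = 4} = {1}" "{u \<in> {0..5 + a + b}. type5 a u = 5} = {4}"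
      "{u \<in> {0..5 + a + b}. type5 a u = 6} = {0}" "{u \<in> {0..5 + a + b}. type5 a u = 7} = {5}"
    by (auto simp: type5 split: if_splits)
  have arcs: "(u, v) \<in> parcs (path_with_pendants 5 a b) \<longleftrightarrow>
      (\<exists>i<5. (u = i \<and> v = Suc i) \<or> (v = i \<and> u = Suc i))
      \<or> (u = 2 \<and> 5 < v \<and> v \<le> 5 + a) \<or> (v = 2 \<and> 5 < u \<and> u \<le> 5 + a)
      \<or> (u = 3 \<and> 5 + a < v \<and> v \<le> 5 + a + b) \<or> (v = 3 \<and> 5 + a < u \<and> u \<le> 5 + a + b)" for u v
    by (auto simp: path_with_pendants_def Let_def)
  have ex5: "(\<exists>i<5. (u = i \<and> v = Suc i) \<or> (v = i \<and> u = Suc i)) \<longleftrightarrow>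
      (u, v) \<in> {(0,1),(1,2),(2,3),(3,4),(4,5),(1,0),(2,1),(3,2),(4,3),(5,4)}" for u v :: nat
    by (auto simp: eval_nat_numeral less_Suc_eq)
  show ?thesis
    unfolding typed_def V arcs
  proof (intro conjI ballI allI impI)
    show "finite {u \<in> {0..5 + a + b}. type5 a u = i}" for i by simp
    show "card {u \<in> {0..5 + a + b}. type5 a u = i} = [1, 1, a, b, 1, 1, 1, 1] ! i" if "i < 8" for i
      using that unfolding less_8_iff by (elim insertE emptyE; hypsubst; simp only: fibres; simp)
  next
    fix u v assume uv: "u \<in> {0..5 + a + b}" "v \<in> {0..5 + a + b}"
    show "((\<exists>i<5. (u = i \<and> v = Suc i) \<or> (v = i \<and> u = Suc i))
      \<or> (u = 2 \<and> 5 < v \<and> v \<le> 5 + a) \<or> (v = 2 \<and> 5 < u \<and> u \<le> 5 + a)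
      \<or> (u = 3 \<and> 5 + a < v \<and> v \<le> 5 + a + b) \<or> (v = 3 \<and> 5 + a < u \<and> u \<le> 5 + a + b))
      = type_adj (type5 a u) (type5 a v)"
    proof (cases "u < 6")
      case True
      show ?thesis
      proof (cases "v < 6")
        case True
        show ?thesis unfolding ex5 type_adj_def type5
          using \<open>u < 6\<close> \<open>v < 6\<close> unfolding lt6 by (elim disjE) simp_all
      next
        case False
        show ?thesis unfolding ex5 type_adj_def type5
          using \<open>u < 6\<close> False uv unfolding lt6 by (elim disjE) auto
      qed
    next
      case False
      show ?thesis
      proof (cases "v < 6")
        case True
        show ?thesis unfolding ex5 type_adj_def type5
          using True False uv unfolding lt6 by (elim disjE) auto
      next
        case v: False
        show ?thesis unfolding ex5 type_adj_def type5
          using v False uv by auto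
      qed
    qed
  qed (auto simp: type5)
qed

section \<open>Numbers and weights of shallow vertices\<close>

context balanced_bicentral
begin

lemma card_V:
  "real (card V) = num_deepest True + num_deepest False
     + real (card (shallow True)) + real (card (shallow False))"
  using sum_V[of "\<lambda>_. 1" True] by (simp add: num_deepest_def)

lemma shallow_centre:
  assumes "k > 0"
  shows "shallow s = insert (centre s) {u \<in> V. side u = s \<and> 0 < depth u \<and> depth u \<noteq> k}"
    (is "_ = insert _ ?A")
proof (intro equalityI subsetI)
  fix u assume "u \<in> shallow s"
  then show "u \<in> insert (centre s) ?A"
    using depth_0[of u] by (cases "depth u = 0") (auto simp: shallow_def)
qed (use centre assms in \<open>auto simp: shallow_def\<close>)

lemma sq_weight_split:
  assumes "k > 0"
  shows "sq_weight s = (real k + 1)\<^sup>2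
    + (\<Sum>u | u \<in> V \<and> side u = s \<and> 0 < depth u \<and> depth u \<noteq> k. (weight u)\<^sup>2)" (is "_ = _ + sum _ ?A")
    and "card (shallow s) = Suc (card {u \<in> V. side u = s \<and> 0 < depth u \<and> depth u \<noteq> k})"
proof -
  have fin: "finite ?A" using finite_V by simp
  have notin: "centre s \<notin> ?A" using centre by simp
  show "sq_weight s = (real k + 1)\<^sup>2 + (\<Sum>u\<in>?A. (weight u)\<^sup>2)"
    unfolding sq_weight_def shallow_centre[OF assms]
    using fin notin centre(3)[of s] by (simp add: weight_def add.commute)
  show "card (shallow s) = Suc (card ?A)"
    unfolding shallow_centre[OF assms] using fin notin by simp
qed

lemma sq_weight_depth_1:
  assumes "k = 1"
  shows "card (shallow s) = 1" "sq_weight s = 4"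
proof -
  have none: "{u \<in> V. side u = s \<and> 0 < depth u \<and> depth u \<noteq> k} = {}"
    using depth_le assms by fastforce
  show "card (shallow s) = 1" "sq_weight s = 4"
    using sq_weight_split[of s, unfolded none] assms by (simp_all add: power2_eq_square)
qed

text \<open>The centre has weight 3 and the other shallow vertices have weight 4; the 7 is
  \<open>16 - 9\<close>.\<close>

lemma sq_weight_depth_2:
  assumes "k = 2"
  shows "sq_weight s = 16 * real (card (shallow s)) - 7"
proof -
  have "weight u = 4" if "u \<in> V" "0 < depth u" "depth u \<noteq> k" for u
  proof -
    have "depth u = 1" using depth_le[OF that(1)] that assms by linarith
    then show ?thesis unfolding weight_def using assms by simp
  qed
  then have "(\<Sum>u | u \<in> V \<and> side u = s \<and> 0 < depth u \<and> depth u \<noteq> k. (weight u)\<^sup>2)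
     = (\<Sum>u | u \<in> V \<and> side u = s \<and> 0 < depth u \<and> depth u \<noteq> k. 16)"
    by (intro sum.cong) auto
  then show ?thesis
    using sq_weight_split[of s] assms by (simp add: power2_eq_square)
qed

text \<open>The weights 3 and 4 found at \<open>k = 2\<close> can only grow with \<open>k\<close>
  and with the depth.\<close>

lemma sq_weight_ge:
  assumes "k \<ge> 2"
  shows "sq_weight s \<ge> 16 * real (card (shallow s)) - 7"
proof -
  have "(\<Sum>u | u \<in> V \<and> side u = s \<and> 0 < depth u \<and> depth u \<noteq> k. 16)
      \<le> (\<Sum>u | u \<in> V \<and> side u = s \<and> 0 < depth u \<and> depth u \<noteq> k. (weight u)\<^sup>2)"
  proof (intro sum_mono)
    fix u assume "u \<in> {u \<in> V. side u = s \<and> 0 < depth u \<and> depth u \<noteq> k}"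
    then have "weight u \<ge> 4" using assms by (simp add: weight_def)
    then have "4\<^sup>2 \<le> (weight u)\<^sup>2" by (intro power_mono) auto
    then show "16 \<le> (weight u)\<^sup>2" by simp
  qed
  moreover have "3\<^sup>2 \<le> (real k + 1)\<^sup>2" using assms by (intro power_mono) auto
  ultimately show ?thesis
    using sq_weight_split[of s] assms by simp
qed

lemma card_shallow_ge_2:
  assumes "k \<ge> 2"
  shows "card (shallow s) \<ge> 2"
proof -
  obtain u where "u \<in> V" "side u = s" "depth u = 1"
    using depth_attained[of 1 s] assms by auto
  then have "{u \<in> V. side u = s \<and> 0 < depth u \<and> depth u \<noteq> k} \<noteq> {}"
    using assms by auto
  then have "card {u \<in> V. side u = s \<and> 0 < depth u \<and> depth u \<noteq> k} > 0"
    using finite_V by (simp add: card_gt_0_iff)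
  then show ?thesis using sq_weight_split(2)[of s] assms by linarith
qed

lemma k_pos:
  assumes "card V \<ge> 3"
  shows "k > 0"
proof (rule ccontr)
  assume "\<not> k > 0"
  then have "u = centre (side u)" if "u \<in> V" for u
    using depth_0[OF that] depth_le[OF that] by simp
  then have "V \<subseteq> {centre True, centre False}"
    by (metis (full_types) insertCI subsetI)
  then have "card V \<le> card {centre True, centre False}" by (intro card_mono) auto
  also have "\<dots> \<le> 2" by (simp add: card_insert_if)
  finally show False using assms by simp
qed

end

text \<open>Otherwise \<open>x\<close> could go to \<open>p\<close>, on to the centre and from there
  to \<open>y\<close> without the edge between \<open>x\<close> and \<open>y\<close>, which is a
  bridge.\<close>

lemma unique_parent:
  assumes tree: "simple_tree T" and "bicentral (pverts T) (parcs T) centre side depth"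
    and xy: "(x, y) \<in> parcs T" "side y = side x" "depth y \<le> depth x"
    and xp: "(x, p) \<in> parcs T" "side p = side x" "depth p < depth x"
  shows "p = y"
proof (rule ccontr)
  interpret bicentral "pverts T" "parcs T" centre side depth by fact
  interpret T: pair_graph T using tree by (simp add: simple_tree_def)
  assume "p \<noteq> y"
  define R where "R = parcs T - {(x, y), (y, x)}"
  have V: "x \<in> pverts T" "y \<in> pverts T" "p \<in> pverts T"
    using xy(1) xp(1) T.wellformed' by auto
  \<comment> \<open>The way through successive parents visits only vertices shallower than
    \<open>x\<close>, so it cannot use the removed edge.\<close>
  have low: "(w, centre (side w)) \<in> R\<^sup>*" if "w \<in> pverts T" "depth w < depth x" for w
    using that
  proof (induction "depth w" arbitrary: w)
    case 0
    then have "w = centre (side w)" using depth_0 by metis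
    then show ?case by (metis rtrancl.rtrancl_refl)
  next
    case (Suc j)
    then obtain v where v: "(w, v) \<in> parcs T" "side v = side w" "depth v = j"
      using parent[of w j] by auto
    then have "(w, v) \<in> R" using Suc.prems Suc.hyps(2) by (auto simp: R_def)
    moreover have "(v, centre (side w)) \<in> R\<^sup>*"
      using Suc.hyps(1)[of v] v Suc.hyps(2) Suc.prems T.wellformed' by auto
    ultimately show ?case by (rule converse_rtrancl_into_rtrancl)
  qed
  have "(y, centre (side x)) \<in> R\<^sup>*"
  proof (cases "depth y < depth x")
    case True
    then show ?thesis using low[OF V(2)] xy(2) by simp
  next
    case False
    then have "depth y = depth x" using xy(3) by simp
    then obtain j where j: "depth y = Suc j" "depth x = Suc j"
      using xp(3) by (cases "depth x") auto
    then obtain v where v: "(y, v) \<in> parcs T" "side v = side y" "depth v = j"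
      using parent[OF V(2)] by auto
    then have "(y, v) \<in> R" using j by (auto simp: R_def)
    moreover have "(v, centre (side x)) \<in> R\<^sup>*"
      using low[of v] v xy(2) j T.wellformed' by auto
    ultimately show ?thesis by (rule converse_rtrancl_into_rtrancl)
  qed
  moreover have "sym (R\<^sup>*)"
    using sym_E by (intro sym_rtrancl) (auto simp: R_def sym_def)
  ultimately have "(centre (side x), y) \<in> R\<^sup>*" by (rule symD[rotated])
  moreover have "(x, p) \<in> R"
    using xp(1,3) \<open>p \<noteq> y\<close> by (auto simp: R_def)
  moreover have "(p, centre (side x)) \<in> R\<^sup>*"
    using low[OF V(3) xp(3)] xp(2) by simp
  ultimately have "(x, y) \<in> R\<^sup>*"
    by (meson converse_rtrancl_into_rtrancl rtrancl_trans)
  then show False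
    using simple_tree_bridge[OF tree xy(1)] by (simp add: R_def)
qed

text \<open>The other end of an edge at equal depth would have to be the parent, which lies one
  level higher; at depth 0 the two ends would coincide.\<close>

lemma same_side_depths:
  assumes tree: "simple_tree T" and "bicentral (pverts T) (parcs T) centre side depth"
    and uv: "(u, v) \<in> parcs T" "side u = side v"
  shows "depth u = Suc (depth v) \<or> depth v = Suc (depth u)"
proof (rule ccontr)
  interpret bicentral "pverts T" "parcs T" centre side depth by fact
  interpret T: pair_graph T using tree by (simp add: simple_tree_def)
  assume not: "\<not> ?thesis"
  have V: "u \<in> pverts T" "v \<in> pverts T" "u \<noteq> v" "(v, u) \<in> parcs T"
    using uv(1) T.wellformed' T.no_loops' T.arcs_symmetric by blast+
  have eq: "depth u = depth v"
    using not same_side[OF uv] same_side[OF V(4)] uv(2) by linarith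
  show False
  proof (cases "depth u")
    case 0
    then have "depth u = 0" "depth v = 0" using eq by simp_all
    then have "centre (side u) = u" "centre (side v) = v"
      by (simp_all only: depth_0[OF V(1), symmetric] depth_0[OF V(2), symmetric])
    then show False using uv(2) V(3) by simp
  next
    case (Suc j)
    then obtain p where p: "(u, p) \<in> parcs T" "side p = side u" "depth p = j"
      using parent[OF V(1)] by auto
    then have "p = v"
      using unique_parent[OF tree assms(2) uv(1)] uv(2) eq Suc by simp
    then show False using p(3) eq Suc by simp
  qed
qed

lemma tree_parents:
  assumes tree: "simple_tree T" and "bicentral (pverts T) (parcs T) centre side depth"
  obtains par where
    "\<And>u. u \<in> pverts T \<Longrightarrow> depth u > 0 \<Longrightarrow>
       par u \<in> pverts T \<and> side (par u) = side u \<and> depth (par u) = depth u - 1"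
    "\<And>u v. u \<in> pverts T \<Longrightarrow> v \<in> pverts T \<Longrightarrow> (u, v) \<in> parcs T \<longleftrightarrow>
       (side u \<noteq> side v \<and> depth u = 0 \<and> depth v = 0)
       \<or> (side u = side v \<and> depth u = Suc (depth v) \<and> v = par u)
       \<or> (side u = side v \<and> depth v = Suc (depth u) \<and> u = par v)"
proof -
  interpret bicentral "pverts T" "parcs T" centre side depth by fact
  interpret T: pair_graph T using tree by (simp add: simple_tree_def)
  define par where
    "par u = (SOME v. (u, v) \<in> parcs T \<and> side v = side u \<and> depth v = depth u - 1)" for u
  have par: "(u, par u) \<in> parcs T \<and> side (par u) = side u \<and> depth (par u) = depth u - 1"
    if "u \<in> pverts T" "depth u > 0" for u
    unfolding par_def
    by (rule someI_ex) (use parent[OF that(1), of "depth u - 1"] that(2) in auto)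
  have up: "v = par u" if "(u, v) \<in> parcs T" "side u = side v" "depth u = Suc (depth v)" for u v
  proof -
    have "u \<in> pverts T" using that(1) T.wellformed' by blast
    then show ?thesis
      using unique_parent[OF tree assms(2), of u v "par u"] par[of u] that by simp
  qed
  show thesis
  proof (rule that)
    show "par u \<in> pverts T \<and> side (par u) = side u \<and> depth (par u) = depth u - 1"
      if "u \<in> pverts T" "depth u > 0" for u
      using par[OF that] T.wellformed' by blast
    fix u v assume V: "u \<in> pverts T" "v \<in> pverts T"
    show "(u, v) \<in> parcs T \<longleftrightarrow>
       (side u \<noteq> side v \<and> depth u = 0 \<and> depth v = 0)
       \<or> (side u = side v \<and> depth u = Suc (depth v) \<and> v = par u)
       \<or> (side u = side v \<and> depth v = Suc (depth u) \<and> u = par v)" (is "?L \<longleftrightarrow> ?A \<or> ?B \<or> ?C")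
    proof
      assume uv: ?L
      then have vu: "(v, u) \<in> parcs T" by (rule T.arcs_symmetric)
      show "?A \<or> ?B \<or> ?C"
      proof (cases "side u = side v")
        case True
        then show ?thesis
          using same_side_depths[OF tree assms(2) uv True] up[OF uv] up[OF vu] by auto
      next
        case False
        then show ?thesis using crossing[OF uv] crossing[OF vu] by simp
      qed
    next
      assume "?A \<or> ?B \<or> ?C"
      then consider ?A | ?B | ?C by blast
      then show ?L
      proof cases
        case 1
        then have "u = centre (side u)" "v = centre (side v)" "side u \<noteq> side v"
          using depth_0 V by blast+
        then show ?thesis using centres_adjacent' by metis
      next
        case 2
        then show ?thesis using par[OF V(1)] by simp
      next
        case 3
        then show ?thesis using par[OF V(2)] T.arcs_symmetric by simp
      qed
    qed
  qed
qed

text \<open>One count \<open>c\<close> covers both families, with \<open>c = 0\<close> and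
  \<open>c = 1\<close>. Since types 4 and 6, and likewise 5 and 7, are equally frequent, each vertex
  at depth 2 finds a parent.\<close>

lemma typed_bicentral:
  assumes wf: "pair_wf_digraph T" and typed: "typed T ty [1, 1, a, b, c, c, c, c]"
  obtains centre where "bicentral (pverts T) (parcs T) centre (\<lambda>u. even (ty u))
    (\<lambda>u. if ty u < 2 then 0 else if ty u < 6 then 1 else 2)"
proof -
  interpret T: pair_wf_digraph T by fact
  define side where "side u \<longleftrightarrow> even (ty u)" for u
  define depth where "depth u = (if ty u < 2 then 0 else if ty u < 6 then 1 else 2 :: nat)" for u
  have ty8: "ty u \<in> {0, 1, 2, 3, 4, 5, 6, 7}" if "u \<in> pverts T" for u
    using typed that by (simp add: typed_def less_8_iff del: One_nat_def)
  have fib: "finite {u \<in> pverts T. ty u = i}"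
      "card {u \<in> pverts T. ty u = i} = [1, 1, a, b, c, c, c, c] ! i" if "i < 8" for i
    using typed that by (simp_all add: typed_def)
  have adj: "(u, v) \<in> parcs T \<longleftrightarrow> u \<in> pverts T \<and> v \<in> pverts T \<and> type_adj (ty u) (ty v)" for u v
    using typed T.wellformed' unfolding typed_def by blast
  obtain x where x: "{u \<in> pverts T. ty u = 0} = {x}"
    using fib(2)[of 0] by (auto simp: card_1_singleton_iff)
  obtain y where y: "{u \<in> pverts T. ty u = 1} = {y}"
    using fib(2)[of 1] by (auto simp: card_1_singleton_iff)
  have xy: "x \<in> pverts T" "ty x = 0" "y \<in> pverts T" "ty y = 1"
    using x y by blast+
  define centre where "centre s = (if s then x else y)" for s
  have other: "\<exists>w\<in>pverts T. ty w = i" if "u \<in> pverts T" "ty u = i + 2" "i = 4 \<or> i = 5" for u i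
  proof -
    have "{w \<in> pverts T. ty w = i + 2} \<noteq> {}" using that by blast
    then have "card {w \<in> pverts T. ty w = i + 2} \<noteq> 0"
      using fib(1)[of "i + 2"] that(3) by (simp only: card_eq_0_iff) auto
    then have "card {w \<in> pverts T. ty w = i} \<noteq> 0"
      using fib(2)[of i] fib(2)[of "i + 2"] that(3) by auto
    then show ?thesis by (metis (mono_tags, lifting) card.empty empty_Collect_eq)
  qed
  have "bicentral (pverts T) (parcs T) centre side depth"
  proof unfold_locales
    have "pverts T = (\<Union>i<8. {u \<in> pverts T. ty u = i})"
      using typed by (auto simp: typed_def)
    moreover have "finite (\<Union>i<8. {u \<in> pverts T. ty u = i})"
      by (intro finite_UN_I fib) auto
    ultimately show "finite (pverts T)" by simp
    show "parcs T \<subseteq> pverts T \<times> pverts T" using T.wellformed' by auto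
    show "sym (parcs T)" by (auto intro!: symI simp: adj type_adj_def)
    show "centre s \<in> pverts T" "side (centre s) = s" "depth (centre s) = 0" for s
      using xy by (auto simp: centre_def side_def depth_def)
    show "u = centre (side u)" if u: "u \<in> pverts T" "depth u = 0" for u
    proof -
      have "ty u = 0 \<or> ty u = 1" using u(2) by (auto simp: depth_def split: if_splits)
      then have "(u = x \<and> side u) \<or> (u = y \<and> \<not> side u)"
        using x y u(1) by (auto simp: side_def)
      then show ?thesis by (auto simp: centre_def)
    qed
    show "(centre True, centre False) \<in> parcs T"
      using xy by (simp add: centre_def adj type_adj_def)
    show "depth u \<le> Suc (depth v)" if "(u, v) \<in> parcs T" "side u = side v" for u v
      using that by (auto simp: adj type_adj_def depth_def side_def)
    show "depth u = 0" if "(u, v) \<in> parcs T" "side u \<noteq> side v" for u v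
      using that by (auto simp: adj type_adj_def depth_def side_def)
    show "\<exists>v. (u, v) \<in> parcs T \<and> side v = side u \<and> depth v = j"
      if u: "u \<in> pverts T" "depth u = Suc j" for u j
    proof -
      have "\<exists>w\<in>pverts T. type_adj (ty u) (ty w) \<and> even (ty w) = even (ty u) \<and> depth w = j"
        using ty8[OF u(1)] u(2) xy other[OF u(1), of 4] other[OF u(1), of 5]
        unfolding insert_iff empty_iff
      proof (elim disjE)
        assume "ty u = 2" then show ?thesis
          using u(2) xy by (intro bexI[of _ x]) (auto simp: depth_def type_adj_def)
      next
        assume "ty u = 3" then show ?thesis
          using u(2) xy by (intro bexI[of _ y]) (auto simp: depth_def type_adj_def)
      next
        assume "ty u = 4" then show ?thesis
          using u(2) xy by (intro bexI[of _ x]) (auto simp: depth_def type_adj_def)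
      next
        assume "ty u = 5" then show ?thesis
          using u(2) xy by (intro bexI[of _ y]) (auto simp: depth_def type_adj_def)
      next
        assume "ty u = 6"
        then obtain w where "w \<in> pverts T" "ty w = 4" using other[OF u(1), of 4] by auto
        then show ?thesis
          using u(2) \<open>ty u = 6\<close> by (intro bexI[of _ w]) (auto simp: depth_def type_adj_def)
      next
        assume "ty u = 7"
        then obtain w where "w \<in> pverts T" "ty w = 5" using other[OF u(1), of 5] by auto
        then show ?thesis
          using u(2) \<open>ty u = 7\<close> by (intro bexI[of _ w]) (auto simp: depth_def type_adj_def)
      qed (use u(2) in \<open>auto simp: depth_def\<close>)
      then show ?thesis using u(1) by (auto simp: adj side_def)
    qed
  qed
  then show thesis
    using that unfolding side_def[abs_def] depth_def[abs_def] by blast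
qed

section \<open>Spectral data computed from class sizes\<close>

lemma typed_spectrum_3:
  assumes wf: "pair_wf_digraph T" and typed: "typed T ty [1, 1, a, b, 0, 0, 0, 0]"
    and "a \<ge> 1" "b \<ge> 1"
  obtains centre side depth where "balanced_bicentral (pverts T) (parcs T) centre side depth 1"
    "balanced_bicentral.spec_trace (pverts T) side depth 1 = 9 * real a * real b + 4 * real a + 4 * real b"
    "balanced_bicentral.spec_det (pverts T) side depth 1 = 16 * real a * real b"
proof -
  define side where "side = (\<lambda>u. even (ty u))"
  define depth where "depth = (\<lambda>u. if ty u < 2 then 0 else if ty u < 6 then 1 else 2 :: nat)"
  obtain centre where "bicentral (pverts T) (parcs T) centre side depth"
    unfolding side_def depth_def by (rule typed_bicentral[OF wf typed])
  then interpret bicentral "pverts T" "parcs T" centre side depth .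
  have fib: "card {u \<in> pverts T. ty u = i} = [1, 1, a, b, 0, 0, 0, 0] ! i" if "i < 8" for i
    using typed that by (simp add: typed_def)
  have "{u \<in> pverts T. ty u = i} = {}" if "i \<in> {4, 5, 6, 7}" for i
    using fib[of i] that finite_V by auto
  then have ty4: "ty u \<in> {0, 1, 2, 3}" if "u \<in> pverts T" for u
    using typed that unfolding typed_def less_8_iff by blast
  have two: "{u \<in> pverts T. side u = True \<and> depth u = 1} = {u \<in> pverts T. ty u = 2}"
    by (intro Collect_cong conj_cong refl, drule ty4) (auto simp: side_def depth_def)
  have three: "{u \<in> pverts T. side u = False \<and> depth u = 1} = {u \<in> pverts T. ty u = 3}"
    by (intro Collect_cong conj_cong refl, drule ty4) (auto simp: side_def depth_def)
  interpret balanced_bicentral "pverts T" "parcs T" centre side depth 1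
  proof unfold_locales
    show "depth u \<le> 1" if "u \<in> pverts T" for u
      using ty4[OF that] by (auto simp: depth_def)
    have "{u \<in> pverts T. ty u = 2} \<noteq> {}" "{u \<in> pverts T. ty u = 3} \<noteq> {}"
      using fib[of 2] fib[of 3] assms(3,4) by (auto simp del: Collect_empty_eq)
    then show "\<exists>u\<in>pverts T. side u = s \<and> depth u = 1" for s
      unfolding two[symmetric] three[symmetric] by (cases s) auto
  qed
  have num: "num_deepest True = a" "num_deepest False = b"
    unfolding num_deepest_def deepest_def two three using fib[of 2] fib[of 3] by simp_all
  show thesis
  proof (rule that)
    show "balanced_bicentral (pverts T) (parcs T) centre side depth 1"
      by (rule balanced_bicentral_axioms)
  qed (simp_all add: spec_trace_def spec_det_def num sq_weight_depth_1(2)[OF refl] del: One_nat_def)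
qed

text \<open>The shallow vertices of a side are its centre, the inner path vertex and the pendants,
  so \<open>sq_weight\<close> is \<open>16 * (a + 2) - 7 = 25 + 16 * a\<close>. The trace collects
  25 from each side and 25 from \<open>5^2\<close>.\<close>

lemma typed_spectrum_5:
  assumes wf: "pair_wf_digraph T" and typed: "typed T ty [1, 1, a, b, 1, 1, 1, 1]"
  obtains centre side depth where "balanced_bicentral (pverts T) (parcs T) centre side depth 2"
    "balanced_bicentral.spec_trace (pverts T) side depth 2 = 75 + 16 * (real a + real b)"
    "balanced_bicentral.spec_det (pverts T) side depth 2 = (25 + 16 * real a) * (25 + 16 * real b)"
proof -
  define side where "side = (\<lambda>u. even (ty u))"
  define depth where "depth = (\<lambda>u. if ty u < 2 then 0 else if ty u < 6 then 1 else 2 :: nat)"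
  obtain centre where "bicentral (pverts T) (parcs T) centre side depth"
    unfolding side_def depth_def by (rule typed_bicentral[OF wf typed])
  then interpret bicentral "pverts T" "parcs T" centre side depth .
  have fib: "card {u \<in> pverts T. ty u = i} = [1, 1, a, b, 1, 1, 1, 1] ! i" if "i < 8" for i
    using typed that by (simp add: typed_def)
  have ty8: "ty u \<in> {0, 1, 2, 3, 4, 5, 6, 7}" if "u \<in> pverts T" for u
    using typed that unfolding typed_def less_8_iff by blast
  have six: "{u \<in> pverts T. side u = True \<and> depth u = 2} = {u \<in> pverts T. ty u = 6}"
    by (intro Collect_cong conj_cong refl, drule ty8) (auto simp: side_def depth_def)
  have seven: "{u \<in> pverts T. side u = False \<and> depth u = 2} = {u \<in> pverts T. ty u = 7}"
    by (intro Collect_cong conj_cong refl, drule ty8) (auto simp: side_def depth_def)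
  interpret balanced_bicentral "pverts T" "parcs T" centre side depth 2
  proof unfold_locales
    show "depth u \<le> 2" if "u \<in> pverts T" for u
      by (auto simp: depth_def)
    have "{u \<in> pverts T. ty u = 6} \<noteq> {}" "{u \<in> pverts T. ty u = 7} \<noteq> {}"
      using fib[of 6] fib[of 7] by (auto simp del: Collect_empty_eq)
    then show "\<exists>u\<in>pverts T. side u = s \<and> depth u = 2" for s
      unfolding six[symmetric] seven[symmetric] by (cases s) auto
  qed
  have num: "num_deepest True = 1" "num_deepest False = 1"
    unfolding num_deepest_def deepest_def six seven using fib[of 6] fib[of 7] by simp_all
  have union: "card (A \<union> B \<union> C) = card A + card B + card C"
    if "A = {u \<in> pverts T. ty u = i}" "B = {u \<in> pverts T. ty u = j}" "C = {u \<in> pverts T. ty u = l}"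
      "i \<noteq> j" "i \<noteq> l" "j \<noteq> l" for A B C i j l
    using that finite_V by (subst card_Un_disjoint; (subst card_Un_disjoint)?) auto
  have "shallow True = {u \<in> pverts T. ty u = 0 \<or> ty u = 2 \<or> ty u = 4}"
    unfolding shallow_def
    by (intro Collect_cong conj_cong refl, drule ty8) (auto simp: side_def depth_def)
  also have "\<dots> = {u \<in> pverts T. ty u = 0} \<union> {u \<in> pverts T. ty u = 2} \<union> {u \<in> pverts T. ty u = 4}"
    by blast
  finally have sT: "card (shallow True) = a + 2"
    using union[of _ 0 _ 2 _ 4] fib[of 0] fib[of 2] fib[of 4] by simp
  have "shallow False = {u \<in> pverts T. ty u = 1 \<or> ty u = 3 \<or> ty u = 5}"
    unfolding shallow_def
    by (intro Collect_cong conj_cong refl, drule ty8) (auto simp: side_def depth_def)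
  also have "\<dots> = {u \<in> pverts T. ty u = 1} \<union> {u \<in> pverts T. ty u = 3} \<union> {u \<in> pverts T. ty u = 5}"
    by blast
  finally have sF: "card (shallow False) = b + 2"
    using union[of _ 1 _ 3 _ 5] fib[of 1] fib[of 3] fib[of 5] by simp
  show thesis
  proof (rule that)
    show "balanced_bicentral (pverts T) (parcs T) centre side depth 2"
      by (rule balanced_bicentral_axioms)
  qed (simp_all add: spec_trace_def spec_det_def num sq_weight_depth_2 sT sF power2_eq_square algebra_simps)
qed

section \<open>Types recovered from a tree\<close>

definition tree_type :: "bool \<Rightarrow> bool \<Rightarrow> nat \<Rightarrow> nat" where
  "tree_type s q d = (if d = 0 then 0 else if d = 2 then 6 else if q then 4 else 2) + (if s then 0 else 1)"

lemma type_adj_tree_type: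
  assumes "d \<le> 2" "e \<le> 2"
  shows "type_adj (tree_type s q d) (tree_type t r e) \<longleftrightarrow>
       (s \<noteq> t \<and> d = 0 \<and> e = 0) \<or> (s = t \<and> d = Suc e \<and> (d = 1 \<or> r)) \<or> (s = t \<and> e = Suc d \<and> (e = 1 \<or> q))"
proof -
  have d: "d = 0 \<or> d = 1 \<or> d = 2" and e: "e = 0 \<or> e = 1 \<or> e = 2" using assms by auto
  from d e show ?thesis
    by (elim disjE; hypsubst; cases s; cases t; cases q; cases r)
       (simp_all add: tree_type_def type_adj_def)
qed

text \<open>A tree of diameter 3 is a double star, fixed by the numbers of leaves at its two
  centres.\<close>

lemma tree_typed_3:
  assumes tree: "simple_tree T"
    and "balanced_bicentral (pverts T) (parcs T) centre side depth 1"
  shows "\<exists>ty. typed T ty [1, 1, card (balanced_bicentral.deepest (pverts T) side depth 1 True),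
     card (balanced_bicentral.deepest (pverts T) side depth 1 False), 0, 0, 0, 0]"
proof -
  interpret balanced_bicentral "pverts T" "parcs T" centre side depth 1 by fact
  obtain par where par: "\<And>u. u \<in> pverts T \<Longrightarrow> depth u > 0 \<Longrightarrow>
       par u \<in> pverts T \<and> side (par u) = side u \<and> depth (par u) = depth u - 1"
    and edge: "\<And>u v. u \<in> pverts T \<Longrightarrow> v \<in> pverts T \<Longrightarrow> (u, v) \<in> parcs T \<longleftrightarrow>
       (side u \<noteq> side v \<and> depth u = 0 \<and> depth v = 0)
       \<or> (side u = side v \<and> depth u = Suc (depth v) \<and> v = par u)
       \<or> (side u = side v \<and> depth v = Suc (depth u) \<and> u = par v)"
    by (rule tree_parents[OF tree bicentral_axioms]) blast
  define ty where "ty u = tree_type (side u) False (depth u)" for u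
  have dep: "depth u = 0 \<or> depth u = 1" if "u \<in> pverts T" for u
    using depth_le[OF that] by auto
  have c: "u = centre (side u) \<longleftrightarrow> depth u = 0" if "u \<in> pverts T" for u
    using depth_0[OF that] centre(3) by metis
  have up: "par u = centre (side u)" if "u \<in> pverts T" "depth u = 1" for u
    using par[of u] depth_0[of "par u"] that by simp
  have adj: "(u, v) \<in> parcs T \<longleftrightarrow> type_adj (ty u) (ty v)"
    if uv: "u \<in> pverts T" "v \<in> pverts T" for u v
  proof -
    have par_iff: "v = par u \<and> depth u = 1"
      if "u \<in> pverts T" "v \<in> pverts T" "side u = side v" "depth u = Suc (depth v)" for u v
    proof -
      have "depth u = 1" "depth v = 0" using dep[OF that(1)] that(4) by simp_all
      then have "v = centre (side v)" by (intro depth_0 that(2))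
      also have "\<dots> = par u" using up[OF that(1) \<open>depth u = 1\<close>] that(3) by simp
      finally show ?thesis using \<open>depth u = 1\<close> by simp
    qed
    have edge': "(u, v) \<in> parcs T \<longleftrightarrow>
       (side u \<noteq> side v \<and> depth u = 0 \<and> depth v = 0)
       \<or> (side u = side v \<and> depth u = Suc (depth v) \<and> (depth u = 1 \<or> False))
       \<or> (side u = side v \<and> depth v = Suc (depth u) \<and> (depth v = 1 \<or> False))"
      unfolding edge[OF uv] using par_iff[OF uv] par_iff[OF uv(2,1)] by metis
    show ?thesis
      unfolding edge' ty_def
      using depth_le[OF uv(1)] depth_le[OF uv(2)] by (intro type_adj_tree_type[symmetric]) simp_all
  qed
  have fibres: "{u \<in> pverts T. ty u = 0} = {centre True}" "{u \<in> pverts T. ty u = 1} = {centre False}"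
      "{u \<in> pverts T. ty u = 2} = deepest True" "{u \<in> pverts T. ty u = 3} = deepest False"
      "{u \<in> pverts T. ty u = 4} = {}" "{u \<in> pverts T. ty u = 5} = {}"
      "{u \<in> pverts T. ty u = 6} = {}" "{u \<in> pverts T. ty u = 7} = {}"
  proof -
    have centre_iff: "u = centre s \<longleftrightarrow> side u = s \<and> depth u = 0" if "u \<in> pverts T" for u s
      using c[OF that] centre(2,3)[of s] by (cases "side u = s") auto
    have singleton: "{u \<in> pverts T. ty u = i} = {x}"
      if "x \<in> pverts T" "\<And>u. u \<in> pverts T \<Longrightarrow> u = x \<longleftrightarrow> ty u = i" for x i
      using that by blast
    show "{u \<in> pverts T. ty u = 0} = {centre True}" "{u \<in> pverts T. ty u = 1} = {centre False}"
      by (rule singleton[OF centre(1)], simp add: centre_iff, simp add: ty_def tree_type_def)+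
    show "{u \<in> pverts T. ty u = 2} = deepest True" "{u \<in> pverts T. ty u = 3} = deepest False"
      unfolding deepest_def
      by (intro Collect_cong conj_cong refl, drule dep, force simp: ty_def tree_type_def)+
    show "{u \<in> pverts T. ty u = 4} = {}" "{u \<in> pverts T. ty u = 5} = {}"
      "{u \<in> pverts T. ty u = 6} = {}" "{u \<in> pverts T. ty u = 7} = {}"
      using dep by (force simp: ty_def tree_type_def split: if_splits)+
  qed
  have "card {u \<in> pverts T. ty u = i} =
      [1, 1, card (deepest True), card (deepest False), 0, 0, 0, 0] ! i" if "i < 8" for i
    using that unfolding less_8_iff by (elim insertE emptyE; hypsubst; simp only: fibres; simp)
  moreover have "ty u < 8" for u by (simp add: ty_def tree_type_def)
  ultimately have "typed T ty [1, 1, card (deepest True), card (deepest False), 0, 0, 0, 0]"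
    unfolding typed_def using adj finite_V by simp
  then show ?thesis by blast
qed

text \<open>With one deepest vertex per side, only its parent \<open>p s\<close> among the vertices
  of depth 1 has a child; the others are leaves at the centre. The centre and \<open>p s\<close> are
  the two vertices subtracted.\<close>

lemma tree_typed_5:
  assumes tree: "simple_tree T"
    and "balanced_bicentral (pverts T) (parcs T) centre side depth 2"
    and single: "\<And>s. card (balanced_bicentral.deepest (pverts T) side depth 2 s) = 1"
  shows "\<exists>ty. typed T ty [1, 1, card (balanced_bicentral.shallow (pverts T) side depth 2 True) - 2,
     card (balanced_bicentral.shallow (pverts T) side depth 2 False) - 2, 1, 1, 1, 1]"
proof -
  interpret balanced_bicentral "pverts T" "parcs T" centre side depth 2 by fact
  obtain par where par: "\<And>u. u \<in> pverts T \<Longrightarrow> depth u > 0 \<Longrightarrow>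
       par u \<in> pverts T \<and> side (par u) = side u \<and> depth (par u) = depth u - 1"
    and edge: "\<And>u v. u \<in> pverts T \<Longrightarrow> v \<in> pverts T \<Longrightarrow> (u, v) \<in> parcs T \<longleftrightarrow>
       (side u \<noteq> side v \<and> depth u = 0 \<and> depth v = 0)
       \<or> (side u = side v \<and> depth u = Suc (depth v) \<and> v = par u)
       \<or> (side u = side v \<and> depth v = Suc (depth u) \<and> u = par v)"
    by (rule tree_parents[OF tree bicentral_axioms]) blast
  have "\<exists>w. deepest s = {w}" for s
    using single[of s] by (simp add: card_1_singleton_iff)
  then obtain w where w: "\<And>s. deepest s = {w s}" by metis
  define p where "p s = par (w s)" for s
  define q where "q u \<longleftrightarrow> u = p (side u)" for u
  define ty where "ty u = tree_type (side u) (q u) (depth u)" for u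
  have dep: "depth u = 0 \<or> depth u = 1 \<or> depth u = 2" if "u \<in> pverts T" for u
    using depth_le[OF that] by auto
  have c: "u = centre (side u) \<longleftrightarrow> depth u = 0" if "u \<in> pverts T" for u
    using depth_0[OF that] centre(3) by metis
  have up: "par u = centre (side u)" if "u \<in> pverts T" "depth u = 1" for u
    using par[of u] depth_0[of "par u"] that by simp
  have w_iff: "u = w (side u) \<longleftrightarrow> depth u = 2" if "u \<in> pverts T" for u
    using w[of "side u"] that by (auto simp: deepest_def)
  have up2: "par u = p (side u)" if "u \<in> pverts T" "depth u = 2" for u
    using w_iff[OF that(1)] that(2) unfolding p_def by metis
  have w_V: "w s \<in> pverts T \<and> side (w s) = s \<and> depth (w s) = 2" for s
    using w[of s] by (auto simp: deepest_def)
  have p_V: "p s \<in> pverts T" "side (p s) = s" "depth (p s) = 1" for s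
    using par[of "w s"] w_V[of s] by (simp_all add: p_def)
  have par_iff: "v = par u \<longleftrightarrow> depth u = 1 \<or> q v"
    if "u \<in> pverts T" "v \<in> pverts T" "side u = side v" "depth u = Suc (depth v)" for u v
  proof (cases "depth u = 1")
    case True
    have "par u = centre (side v)" using up[OF that(1) True] that(3) by simp
    also have "\<dots> = v" using True that(4) by (intro depth_0[OF that(2), symmetric]) simp
    finally show ?thesis using True by simp
  next
    case False
    then have "depth u = 2" using dep[OF that(1)] that(4) by simp
    then show ?thesis using up2[OF that(1)] that(3) unfolding q_def by simp
  qed
  have edge': "(u, v) \<in> parcs T \<longleftrightarrow>
       (side u \<noteq> side v \<and> depth u = 0 \<and> depth v = 0)
       \<or> (side u = side v \<and> depth u = Suc (depth v) \<and> (depth u = 1 \<or> q v))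
       \<or> (side u = side v \<and> depth v = Suc (depth u) \<and> (depth v = 1 \<or> q u))"
    if uv: "u \<in> pverts T" "v \<in> pverts T" for u v
    unfolding edge[OF uv] using par_iff[OF uv] par_iff[OF uv(2,1)] by metis
  have adj: "(u, v) \<in> parcs T \<longleftrightarrow> type_adj (ty u) (ty v)"
    if uv: "u \<in> pverts T" "v \<in> pverts T" for u v
    unfolding edge'[OF uv] ty_def
    using depth_le[OF uv(1)] depth_le[OF uv(2)] by (rule type_adj_tree_type[symmetric])
  have shallow: "shallow s = insert (centre s) (insert (p s) {u \<in> pverts T. ty u = (if s then 2 else 3)})" for s
  proof (intro equalityI subsetI)
    fix u assume u: "u \<in> shallow s"
    then show "u \<in> insert (centre s) (insert (p s) {u \<in> pverts T. ty u = (if s then 2 else 3)})"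
      using dep[of u] c[of u] by (auto simp: shallow_def ty_def tree_type_def q_def)
  next
    fix u assume "u \<in> insert (centre s) (insert (p s) {u \<in> pverts T. ty u = (if s then 2 else 3)})"
    then show "u \<in> shallow s"
      using centre[of s] p_V[of s] by (auto simp: shallow_def ty_def tree_type_def q_def split: if_splits)
  qed
  have c4: "centre s \<notin> insert (p s) {u \<in> pverts T. ty u = (if s then 2 else 3)}"
      "p s \<notin> {u \<in> pverts T. ty u = (if s then 2 else 3)}" for s
    using centre[of s] p_V[of s] by (auto simp: ty_def tree_type_def q_def)
  have card_shallow: "card (shallow s) = Suc (Suc (card {u \<in> pverts T. ty u = (if s then 2 else 3)}))" for s
    unfolding shallow using c4[of s] finite_V by simp
  have fibres: "{u \<in> pverts T. ty u = 0} = {centre True}" "{u \<in> pverts T. ty u = 1} = {centre False}"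
      "{u \<in> pverts T. ty u = 4} = {p True}" "{u \<in> pverts T. ty u = 5} = {p False}"
      "{u \<in> pverts T. ty u = 6} = {w True}" "{u \<in> pverts T. ty u = 7} = {w False}"
  proof -
    have singleton: "{u \<in> pverts T. ty u = i} = {x}"
      if "x \<in> pverts T" "\<And>u. u \<in> pverts T \<Longrightarrow> u = x \<longleftrightarrow> ty u = i" for x i
      using that by blast
    have centre_iff: "u = centre s \<longleftrightarrow> side u = s \<and> depth u = 0" if "u \<in> pverts T" for u s
      using c[OF that] centre(2,3)[of s] by (cases "side u = s") auto
    have w_iff: "u = w s \<longleftrightarrow> side u = s \<and> depth u = 2" if "u \<in> pverts T" for u s
      using w[of s] that by (auto simp: deepest_def)
    have p_iff: "u = p s \<longleftrightarrow> side u = s \<and> depth u = 1 \<and> q u" if "u \<in> pverts T" for u s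
      using p_V(2,3)[of s] unfolding q_def by (cases "side u = s") auto
    show "{u \<in> pverts T. ty u = 0} = {centre True}" "{u \<in> pverts T. ty u = 1} = {centre False}"
      by (rule singleton[OF centre(1)], simp add: centre_iff, simp add: ty_def tree_type_def)+
    show "{u \<in> pverts T. ty u = 4} = {p True}" "{u \<in> pverts T. ty u = 5} = {p False}"
      by (rule singleton[OF p_V(1)], frule dep, force simp: p_iff ty_def tree_type_def)+
    show "{u \<in> pverts T. ty u = 6} = {w True}" "{u \<in> pverts T. ty u = 7} = {w False}"
      by (rule singleton[OF conjunct1[OF w_V]], simp add: w_iff, simp add: ty_def tree_type_def)+
  qed
  have fibres': "card {u \<in> pverts T. ty u = 2} = card (shallow True) - 2"
      "card {u \<in> pverts T. ty u = 3} = card (shallow False) - 2"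
    using card_shallow[of True] card_shallow[of False] by simp_all
  have "card {u \<in> pverts T. ty u = i} =
      [1, 1, card (shallow True) - 2, card (shallow False) - 2, 1, 1, 1, 1] ! i" if "i < 8" for i
    using that unfolding less_8_iff
    by (elim insertE emptyE; hypsubst; simp only: fibres fibres'; simp)
  moreover have "ty u < 8" for u by (simp add: ty_def tree_type_def q_def)
  ultimately have "typed T ty [1, 1, card (shallow True) - 2, card (shallow False) - 2, 1, 1, 1, 1]"
    unfolding typed_def using adj finite_V by simp
  then show ?thesis by blast
qed

section \<open>Comparison with the extremal trees\<close>

text \<open>\<open>model_poly\<close> is the characteristic polynomial in \<open>t = \<xi>\<^sup>2\<close> for depth 2 when the sides have \<open>a\<close> and
  \<open>b\<close> deepest and \<open>m\<close> and \<open>p\<close> other vertices.\<close>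

definition model_poly :: "nat \<Rightarrow> nat \<Rightarrow> nat \<Rightarrow> nat \<Rightarrow> real \<Rightarrow> real" where
  "model_poly a b m p t = (t - real a * (16 * real p - 7)) * (t - real b * (16 * real m - 7))
     - 25 * real a * real b * t"

text \<open>For positive \<open>t\<close> a root-free way to say that \<open>t\<close> is strictly
  below the larger root of \<open>model_poly\<close>. At either of the two thresholds the product
  vanishes and the polynomial is negative, so the larger root exceeds both; the sign at
  \<open>t\<close> is decisive only beyond them.\<close>

definition below_model :: "nat \<Rightarrow> nat \<Rightarrow> nat \<Rightarrow> nat \<Rightarrow> real \<Rightarrow> bool" where
  "below_model a b m p t \<longleftrightarrow> t < real a * (16 * real p - 7) \<or> t < real b * (16 * real m - 7)
     \<or> model_poly a b m p t < 0"

lemma below_model_swap: "below_model a b m p t \<longleftrightarrow> below_model b a p m t"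
  by (auto simp: below_model_def model_poly_def mult.commute mult.left_commute)

text \<open>Turning a deepest vertex into one of depth 1 on its side lowers the root: it raises the
  polynomial at \<open>t\<close> by \<open>d * (t - F) + 9 * B * t + 16 * B * G\<close>. The 9 is
  \<open>25 - 16\<close>, the loss in the crossing term against the gain in squared weight.\<close>

lemma below_model_shift:
  assumes "t > 0" "a \<ge> 1" "b \<ge> 1" "m \<ge> 1" "p \<ge> 1"
    and shifted: "below_model a b (Suc m) p t \<or> model_poly a b (Suc m) p t \<le> 0"
  shows "below_model (Suc a) b m p t"
proof (rule ccontr)
  define A B F G where "A = real a" and "B = real b" and "F = B * (16 * real m - 7)"
    and "G = A * (16 * real p - 7)"
  define d where "d = 16 * real p - 7"
  have pos: "A \<ge> 1" "B \<ge> 1" "d \<ge> 9" "G \<ge> 0" "F \<ge> 0"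
    using assms by (auto simp: A_def B_def d_def G_def F_def)
  have poly: "model_poly (Suc a) b m p t = (t - (G + d)) * (t - F) - 25 * (A + 1) * B * t"
      "model_poly a b (Suc m) p t = (t - G) * (t - (F + 16 * B)) - 25 * A * B * t"
    by (simp_all add: model_poly_def A_def B_def F_def G_def d_def algebra_simps)
  assume "\<not> below_model (Suc a) b m p t"
  then have ge: "t \<ge> G + d" "t \<ge> F" and nonneg: "model_poly (Suc a) b m p t \<ge> 0"
    by (auto simp: below_model_def A_def B_def F_def G_def d_def algebra_simps)
  show False
  proof (cases "t \<le> F + 16 * B")
    case True
    \<comment> \<open>Here \<open>t\<close> may lie under the raised threshold
      \<open>F + 16 * B\<close>, where the hypothesis says nothing; but then the product is too
      small to outweigh the crossing term.\<close>
    have "(t - (G + d)) * (t - F) \<le> t * (16 * B)"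
      using ge True pos by (intro mult_mono) auto
    also have "\<dots> < 25 * (A + 1) * B * t"
    proof -
      have "16 * (B * t) < 25 * (A + 1) * (B * t)"
        using pos assms(1) by (intro mult_strict_right_mono) auto
      then show ?thesis by (simp add: algebra_simps)
    qed
    finally show False using nonneg poly(1) by simp
  next
    case False
    have "real b * (16 * real (Suc m) - 7) = F + 16 * B"
      by (simp add: F_def B_def algebra_simps)
    then have "model_poly a b (Suc m) p t \<le> 0"
      using shifted False ge pos by (auto simp: below_model_def G_def[symmetric] A_def[symmetric])
    moreover have "model_poly a b (Suc m) p t - model_poly (Suc a) b m p t
        = d * (t - F) + 9 * B * t + 16 * B * G"
      unfolding poly by (simp add: algebra_simps)
    moreover have "d * (t - F) > 0" using False pos by (intro mult_pos_pos) auto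
    moreover have "9 * B * t \<ge> 0" "16 * B * G \<ge> 0" using pos assms(1) by auto
    ultimately show False using nonneg by linarith
  qed
qed

text \<open>Each shift turns a weak inequality into a strict one, so equality can survive only at
  \<open>a = b = 1\<close>, where no shift is made.\<close>

lemma below_model_if_not_single:
  assumes "t > 0" "a \<ge> 1" "b \<ge> 1" "m \<ge> 1" "p \<ge> 1" "a + b > 2"
    and base: "\<And>m' p'. m' + p' + 2 = a + b + m + p \<Longrightarrow> model_poly 1 1 m' p' t \<le> 0"
  shows "below_model a b m p t"
  using assms(2-)
proof (induction "a + b" arbitrary: a b m p rule: less_induct)
  case less
  have weak: "below_model a' b' m' p' t \<or> model_poly a' b' m' p' t \<le> 0"
    if "a' + b' < a + b" "a' \<ge> 1" "b' \<ge> 1" "m' \<ge> 1" "p' \<ge> 1" "a' + b' + m' + p' = a + b + m + p"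
    for a' b' m' p'
  proof (cases "a' + b' = 2")
    case True
    then have "a' = 1" "b' = 1" using that by auto
    then show ?thesis using less.prems(6)[of m' p'] that by simp
  next
    case False
    then show ?thesis using less.hyps[OF that(1-5)] less.prems(6) that by auto
  qed
  show ?case
  proof (cases "a \<ge> 2")
    case True
    then obtain c where c: "a = Suc c" "c \<ge> 1" by (cases a) auto
    show ?thesis unfolding c(1)
      by (rule below_model_shift[OF assms(1) c(2)]) (use less.prems c weak[of c b "Suc m" p] in auto)
  next
    case False
    then obtain c where c: "b = Suc c" "c \<ge> 1" using less.prems by (cases b) auto
    \<comment> \<open>The shift acts on the first count, so the sides are exchanged in order to
      lower \<open>b\<close>.\<close>
    have "below_model c a (Suc p) m t \<or> model_poly c a (Suc p) m t \<le> 0"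
      using weak[of a c m "Suc p"] less.prems c below_model_swap[of a c m "Suc p" t]
      by (auto simp: model_poly_def mult.commute mult.left_commute)
    then have "below_model b a p m t"
      unfolding c(1) by (intro below_model_shift[OF assms(1) c(2)]) (use less.prems in auto)
    then show ?thesis by (simp add: below_model_swap[of a b])
  qed
qed

text \<open>If the smaller factor is \<open>e\<close> below the lower half and \<open>h\<close>
  below the upper half, the product falls short by exactly \<open>e * h\<close>, which vanishes only
  for \<open>e = 0\<close>.\<close>

lemma prod_le_halves:
  fixes m p N :: nat
  assumes "m + p = N"
  shows "m * p \<le> (N div 2) * ((N + 1) div 2)"
    and "m * p = (N div 2) * ((N + 1) div 2) \<Longrightarrow> {m, p} = {N div 2, (N + 1) div 2}"
proof -
  have *: "m * p \<le> (N div 2) * ((N + 1) div 2) \<and>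
     (m * p = (N div 2) * ((N + 1) div 2) \<longrightarrow> {m, p} = {N div 2, (N + 1) div 2})"
    if "m + p = N" "m \<le> p" for m p
  proof -
    define e where "e = N div 2 - m"
    have "m \<le> N div 2" using that by auto
    then have e: "m + e = N div 2" by (simp add: e_def)
    have "N = N div 2 + (N + 1) div 2" by presburger
    then have p: "p = (N + 1) div 2 + e" using that e by simp
    have le: "N div 2 \<le> (N + 1) div 2" by presburger
    define h where "h = (N + 1) div 2 - m"
    have h: "m + h = (N + 1) div 2" "e \<le> h" using le e by (simp_all add: h_def)
    have "(N div 2) * ((N + 1) div 2) = m * p + e * h"
      unfolding p e[symmetric] h(1)[symmetric] by (simp add: algebra_simps)
    then show ?thesis
      using e p h by (cases "e = 0") auto
  qed
  show "m * p \<le> (N div 2) * ((N + 1) div 2)"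
    "m * p = (N div 2) * ((N + 1) div 2) \<Longrightarrow> {m, p} = {N div 2, (N + 1) div 2}"
    using *[of m p] *[of p m] assms by (cases "m \<le> p"; auto simp: mult.commute insert_commute)+
qed

section \<open>Numerical comparison of the two candidates\<close>

definition half_prod :: "nat \<Rightarrow> real" where
  "half_prod N = real ((N div 2) * ((N + 1) div 2))"

lemma half_prod_even: "even N \<Longrightarrow> 4 * half_prod N = (real N)\<^sup>2"
  and half_prod_odd: "odd N \<Longrightarrow> 4 * half_prod N = (real N)\<^sup>2 - 1"
  by (auto elim!: evenE oddE simp: half_prod_def power2_eq_square algebra_simps)

text \<open>This is \<open>model_poly 1 1 m p\<close> for a balanced splitting
  \<open>m + p = N\<close>; with the sum fixed it depends on the splitting only through
  \<open>m * p\<close>.\<close>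

definition extremal_poly :: "nat \<Rightarrow> real \<Rightarrow> real" where
  "extremal_poly N t = (t + 7)\<^sup>2 - 16 * (t + 7) * real N + 256 * half_prod N - 25 * t"

lemma model_poly_single:
  assumes "m + p = N"
  shows "model_poly 1 1 m p t = extremal_poly N t - 256 * (half_prod N - real (m * p))"
  by (simp add: model_poly_def extremal_poly_def assms[symmetric] power2_eq_square algebra_simps)

text \<open>The roots add up to \<open>S\<close> and the smaller one is at most 2, which gives the
  bound \<open>S - 2\<close>.\<close>

lemma larger_root_13_ge:
  assumes "n \<ge> (4::real)"
  defines "S \<equiv> 13 * n - 35" and "P \<equiv> 16 * (n - 3)"
  shows "larger_root S P \<ge> 13 * n - 37" "(larger_root S P)\<^sup>2 - S * larger_root S P + P = 0"
proof -
  have "(13 * n - 37)\<^sup>2 - S * (13 * n - 37) + P \<le> 0"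
    using assms(1) unfolding S_def P_def by (simp add: power2_eq_square algebra_simps)
  then show "larger_root S P \<ge> 13 * n - 37" by (rule le_larger_root)
  have "64 * (n - 3) \<le> (13 * n - 35)\<^sup>2"
  proof -
    \<comment> \<open>The factor 17 is the value of \<open>13 * n - 35\<close> at
      \<open>n = 4\<close>.\<close>
    have "64 * (n - 3) \<le> 17 * (13 * n - 35)" using assms(1) by simp
    also have "\<dots> \<le> (13 * n - 35)\<^sup>2"
      unfolding power2_eq_square using assms(1) by (intro mult_right_mono) auto
    finally show ?thesis .
  qed
  then show "(larger_root S P)\<^sup>2 - S * larger_root S P + P = 0"
    unfolding S_def P_def by (intro larger_root_is_root) simp
qed

text \<open>Replacing \<open>half_prod N\<close> by \<open>N^2 / 4\<close> removes the parity and
  completes the square \<open>(t + 23 - 8 * n)^2\<close>, from which \<open>25 * t\<close> is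
  subtracted.\<close>

lemma extremal_poly_le:
  assumes "n \<ge> 2"
  shows "extremal_poly (n - 2) t \<le> t\<^sup>2 - (16 * real n - 21) * t + (8 * real n - 23)\<^sup>2"
proof -
  have "4 * half_prod (n - 2) \<le> (real (n - 2))\<^sup>2"
    using half_prod_even[of "n - 2"] half_prod_odd[of "n - 2"] by (cases "even (n - 2)") auto
  then have "256 * half_prod (n - 2) \<le> 64 * (real n - 2)\<^sup>2" using assms by (simp add: of_nat_diff)
  then show ?thesis
    using assms unfolding extremal_poly_def by (simp add: of_nat_diff power2_eq_square algebra_simps)
qed

text \<open>Subtracting \<open>zero\<close> leaves an expression linear in \<open>t\<close> with
  slope \<open>-(3 * n + 14)\<close>, so the lower bound for \<open>t\<close> suffices.\<close>

lemma extremal_poly_neg: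
  assumes "6 \<le> n" "n \<le> 15" and t: "t \<ge> 13 * real n - 37"
    and zero: "t\<^sup>2 - (13 * real n - 35) * t + 16 * (real n - 3) = 0"
  shows "extremal_poly (n - 2) t < 0"
proof -
  have "(3 * real n + 14) * t \<ge> (3 * real n + 14) * (13 * real n - 37)"
    using t by (intro mult_left_mono) auto
  \<comment> \<open>What remains after inserting the lower bound for \<open>t\<close>. It is
    negative from 6 to 15 and positive at 16.\<close>
  moreover have "25 * (real n)\<^sup>2 - 455 * real n + 1095 < 0"
  proof -
    have "25 * (real n)\<^sup>2 - 455 * real n + 1095 = 25 * ((real n - 6) * (real n - 15)) + 70 * real n - 1155 "
      by (simp add: power2_eq_square algebra_simps)
    moreover have "(real n - 6) * (real n - 15) \<le> 0"
      using assms(1,2) by (intro mult_nonneg_nonpos) auto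
    ultimately show ?thesis using assms(2) by simp
  qed
  ultimately have "t\<^sup>2 - (16 * real n - 21) * t + (8 * real n - 23)\<^sup>2 < 0"
    using zero by (simp add: power2_eq_square algebra_simps)
  then show ?thesis using extremal_poly_le[of n t] assms(1) by simp
qed

text \<open>The constant term of \<open>extremal_poly (n - 2)\<close>; an odd number of vertices
  cannot be balanced exactly, which costs \<open>256 / 4 = 64\<close>.\<close>

definition extremal_det :: "nat \<Rightarrow> real" where
  "extremal_det n = (8 * real n - 23)\<^sup>2 - (if odd n then 64 else 0)"

lemma extremal_poly_eq:
  assumes "n \<ge> 2"
  shows "extremal_poly (n - 2) t = t\<^sup>2 - (16 * real n - 21) * t + extremal_det n"
proof -
  have "256 * half_prod (n - 2) = 64 * (real n - 2)\<^sup>2 - (if odd n then 64 else 0)"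
    using half_prod_even[of "n - 2"] half_prod_odd[of "n - 2"] assms by (cases "even n") (simp_all add: of_nat_diff)
  then show ?thesis
    using assms unfolding extremal_poly_def extremal_det_def
    by (simp add: of_nat_diff power2_eq_square algebra_simps)
qed

text \<open>The counterpart of \<open>extremal_poly_neg\<close>: from 16 on, the depth 1 polynomial
  is negative at the root of the balanced tree. Again the difference of the two quadratics is linear
  in \<open>t\<close>, now controlled by an upper bound.\<close>

lemma larger_root_16:
  assumes "n \<ge> 16"
  defines "t \<equiv> larger_root (16 * real n - 21) (extremal_det n)"
  shows "t \<ge> 8 * real n - 21 / 2" "t\<^sup>2 - (16 * real n - 21) * t + extremal_det n = 0"
    and "t\<^sup>2 - (13 * real n - 35) * t + 16 * (real n - 3) < 0"
proof -
  have n: "real n \<ge> 16" using assms(1) by simp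
  define D where "D = (16 * real n - 21)\<^sup>2 - 4 * extremal_det n"
  have D: "D = 800 * real n - 1675 + (if odd n then 256 else 0)"
    by (simp add: D_def extremal_det_def power2_eq_square algebra_simps)
  have "D \<ge> 0" using D n by simp
  have t: "t = (16 * real n - 21 + sqrt D) / 2" by (simp add: t_def larger_root_def D_def)
  show "t \<ge> 8 * real n - 21 / 2" using real_sqrt_ge_zero[OF \<open>D \<ge> 0\<close>] unfolding t by (simp add: field_simps)
  show zero: "t\<^sup>2 - (16 * real n - 21) * t + extremal_det n = 0"
    unfolding t_def using \<open>D \<ge> 0\<close> D_def by (intro larger_root_is_root) simp
  text \<open>The tangent of the square root at \<open>107\<^sup>2\<close>, which is close to \<open>D\<close> for \<open>n = 16\<close>.\<close>
  have "sqrt D \<le> (800 * real n + 10030) / 214"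
  proof -
    have "0 \<le> (sqrt D - 107)\<^sup>2" by simp
    also have "\<dots> = D - 214 * sqrt D + 11449"
      using \<open>D \<ge> 0\<close> by (simp add: power2_eq_square algebra_simps)
    finally show ?thesis using D by (simp split: if_splits)
  qed
  then have "(3 * real n + 14) * t \<le> (3 * real n + 14) * ((16 * real n - 21 + (800 * real n + 10030) / 214) / 2)"
    unfolding t by (intro mult_left_mono) auto
  also have "\<dots> < extremal_det n - 16 * (real n - 3)"
  proof -
    \<comment> \<open>This is 428 times the difference of the two sides for the odd value of
      \<open>extremal_det\<close>, the smaller one. It is negative at 15.\<close>
    have "0 < 14720 * (real n)\<^sup>2 - 240096 * real n + 142060"
    proof -
      have "0 \<le> (real n - 16)\<^sup>2" by simp
      then have "32 * real n - 256 \<le> (real n)\<^sup>2" by (simp add: power2_eq_square algebra_simps)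
      then show ?thesis using n by linarith
    qed
    then show ?thesis unfolding extremal_det_def by (simp add: field_simps power2_eq_square)
  qed
  finally show "t\<^sup>2 - (13 * real n - 35) * t + 16 * (real n - 3) < 0"
    using zero by (simp add: algebra_simps)
qed

section \<open>A given tree tested at a candidate root\<close>

context balanced_bicentral
begin

definition sq_radius :: real where
  "sq_radius = larger_root spec_trace spec_det"

lemma le_sq_radius: "spec_poly t \<le> 0 \<Longrightarrow> t \<le> sq_radius"
  unfolding sq_radius_def spec_poly_eq by (rule le_larger_root)

lemma less_sq_radius: "spec_poly t < 0 \<Longrightarrow> t < sq_radius"
  unfolding sq_radius_def spec_poly_eq by (rule less_larger_root)

text \<open>At this point the product in \<open>spec_poly\<close> vanishes and only the negative
  term is left.\<close>

lemma sq_weight_le_sq_radius: "num_deepest s * sq_weight (\<not> s) \<le> sq_radius"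
proof (rule le_sq_radius)
  have "0 \<le> (real (2 * k + 1))\<^sup>2 * num_deepest True * num_deepest False
      * (num_deepest s * sq_weight (\<not> s))"
    using num_deepest_ge_1[of True] num_deepest_ge_1[of False] num_deepest_ge_1[of s]
      sq_weight_nonneg[of "\<not> s"] by (intro mult_nonneg_nonneg) auto
  then show "spec_poly (num_deepest s * sq_weight (\<not> s)) \<le> 0"
    by (cases s) (auto simp: spec_poly_def)
qed

text \<open>The sum of \<open>a\<close> and \<open>b\<close> is fixed and
  \<open>a * b = n - 3 + (a - 1) * (b - 1)\<close>. So the polynomial lies below that of the case
  \<open>a = 1\<close> by \<open>(a - 1) * (b - 1) * (9 * t - 16)\<close>, and \<open>t > 2\<close>
  makes the last factor positive.\<close>

lemma compare_depth_1:
  assumes "k = 1" and t: "t > 2"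
    and poly: "t\<^sup>2 - (13 * real (card V) - 35) * t + 16 * (real (card V) - 3) \<le> 0"
  shows "t < sq_radius \<or>
    t \<le> sq_radius \<and> t\<^sup>2 - (13 * real (card V) - 35) * t + 16 * (real (card V) - 3) = 0
      \<and> (num_deepest True = 1 \<or> num_deepest False = 1)"
proof -
  define a b where "a = num_deepest True" and "b = num_deepest False"
  have ab: "a \<ge> 1" "b \<ge> 1" using num_deepest_ge_1 by (simp_all add: a_def b_def)
  have n: "real (card V) = a + b + 2"
    using card_V sq_weight_depth_1(1)[OF assms(1)] by (simp add: a_def b_def)
  have eq: "spec_poly t = t\<^sup>2 - (13 * real (card V) - 35) * t + 16 * (real (card V) - 3)
      - (a - 1) * (b - 1) * (9 * t - 16)"
    unfolding spec_poly_def sq_weight_depth_1(2)[OF assms(1)] a_def[symmetric] b_def[symmetric] n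
    using assms(1) by (simp add: power2_eq_square algebra_simps)
  have "(a - 1) * (b - 1) * (9 * t - 16) \<ge> 0" using ab t by auto
  then have le: "spec_poly t \<le> 0" using eq poly by simp
  show ?thesis
  proof (cases "spec_poly t < 0")
    case True
    then show ?thesis using less_sq_radius by blast
  next
    case False
    then have "(a - 1) * (b - 1) * (9 * t - 16) = 0"
        "t\<^sup>2 - (13 * real (card V) - 35) * t + 16 * (real (card V) - 3) = 0"
      using eq poly \<open>(a - 1) * (b - 1) * (9 * t - 16) \<ge> 0\<close> by linarith+
    then show ?thesis using le_sq_radius[OF le] t by (auto simp: a_def b_def)
  qed
qed

text \<open>A \<open>t\<close> below \<open>F\<close> or \<open>G\<close> is settled at once. Beyond
  both, the weights are lowered to depth 2, several deepest vertices give strictness, and a single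
  one per side leaves only imbalance and extra depth as sources of strictness.\<close>

lemma compare_depth_ge_2:
  assumes k: "k \<ge> 2" and t: "t > 0" and poly: "extremal_poly (card V - 2) t \<le> 0"
  shows "t < sq_radius \<or>
    t \<le> sq_radius \<and> k = 2 \<and> (\<forall>s. card (deepest s) = 1) \<and>
    {card (shallow True), card (shallow False)} = {(card V - 2) div 2, (card V - 1) div 2} \<and>
    extremal_poly (card V - 2) t = 0"
proof -
  define a b m p where "a = card (deepest True)" and "b = card (deepest False)"
    and "m = card (shallow True)" and "p = card (shallow False)"
  define F G where "F = num_deepest True * sq_weight False" and "G = num_deepest False * sq_weight True"
  have num: "num_deepest True = real a" "num_deepest False = real b"
    by (simp_all add: num_deepest_def a_def b_def)
  have ge: "a \<ge> 1" "b \<ge> 1" "m \<ge> 2" "p \<ge> 2"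
    using num_deepest_ge_1[of True] num_deepest_ge_1[of False] card_shallow_ge_2[OF k]
    by (simp_all add: num m_def p_def)
  have n: "card V = a + b + m + p"
    using card_V unfolding num m_def[symmetric] p_def[symmetric] by linarith
  have FG: "F \<ge> real a * (16 * real p - 7)" "G \<ge> real b * (16 * real m - 7)"
    unfolding F_def G_def num m_def p_def by (intro mult_left_mono sq_weight_ge[OF k]; simp)+
  have "5\<^sup>2 \<le> (real (2 * k + 1))\<^sup>2" using k by (intro power_mono) auto
  then have d: "25 \<le> (real (2 * k + 1))\<^sup>2" by simp
  have poly_le: "spec_poly t \<le> model_poly a b m p t - ((real (2 * k + 1))\<^sup>2 - 25) * (real a * real b * t)"
    if "t \<ge> F" "t \<ge> G"
  proof -
    \<comment> \<open>Lowering the weights enlarges both factors; their nonnegativity is what makes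
      the product follow.\<close>
    have "(t - F) * (t - G) \<le> (t - real a * (16 * real p - 7)) * (t - real b * (16 * real m - 7))"
      using that FG by (intro mult_mono) auto
    moreover have "spec_poly t = (t - F) * (t - G) - (real (2 * k + 1))\<^sup>2 * (real a * real b * t)"
      by (simp add: spec_poly_def F_def G_def num)
    moreover have "((real (2 * k + 1))\<^sup>2 - 25) * (real a * real b * t)
        = (real (2 * k + 1))\<^sup>2 * (real a * real b * t) - 25 * real a * real b * t"
      by (simp add: left_diff_distrib)
    ultimately show ?thesis unfolding model_poly_def by linarith
  qed
  have excess: "((real (2 * k + 1))\<^sup>2 - 25) * (real a * real b * t) \<ge> 0"
    using d t by (intro mult_nonneg_nonneg) auto
  show ?thesis
  proof (cases "t \<ge> F \<and> t \<ge> G")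
    case False
    then show ?thesis
      using sq_weight_le_sq_radius[of True] sq_weight_le_sq_radius[of False] by (auto simp: F_def G_def)
  next
    case True
    show ?thesis
    proof (cases "a + b > 2")
      case gt: True
      have "below_model a b m p t"
      proof (rule below_model_if_not_single[OF t _ _ _ _ gt])
        fix m' p' assume "m' + p' + 2 = a + b + m + p"
        then have N: "m' + p' = card V - 2" using n by simp
        show "model_poly 1 1 m' p' t \<le> 0"
          unfolding model_poly_single[OF N] using poly prod_le_halves(1)[OF N]
          by (simp add: half_prod_def flip: of_nat_mult)
      qed (use ge in auto)
      then have "model_poly a b m p t < 0"
        using True FG by (auto simp: below_model_def)
      then show ?thesis
        using poly_le True excess less_sq_radius[of t] by auto
    next
      case False
      then have one: "a = 1" "b = 1" using ge by auto
      have N: "m + p = card V - 2" using n one by simp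
      have prod: "real (m * p) \<le> half_prod (card V - 2)"
        unfolding half_prod_def using prod_le_halves(1)[OF N] by (simp only: of_nat_le_iff)
      \<comment> \<open>\<open>H\<close> measures the imbalance and \<open>X\<close> the depth
        beyond 2; both must vanish in the case of equality.\<close>
      define H where "H = half_prod (card V - 2) - real (m * p)"
      define X where "X = ((real (2 * k + 1))\<^sup>2 - 25) * t"
      have upper: "spec_poly t \<le> extremal_poly (card V - 2) t - 256 * H - X"
        using poly_le True unfolding one model_poly_single[OF N] H_def X_def by simp
      have nonneg: "H \<ge> 0" "X \<ge> 0"
        using prod d t by (auto simp: H_def X_def)
      show ?thesis
      proof (cases "spec_poly t < 0")
        case True
        then show ?thesis using less_sq_radius by blast
      next
        case False
        then have "spec_poly t \<le> 0" "extremal_poly (card V - 2) t = 0" "H = 0" "X = 0"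
          using upper nonneg poly by linarith+
        then have tight: "spec_poly t \<le> 0" "extremal_poly (card V - 2) t = 0"
          "half_prod (card V - 2) = real (m * p)" "(real (2 * k + 1))\<^sup>2 = 25"
          using t by (simp_all add: H_def X_def)
        have "k = 2"
        proof (rule ccontr)
          assume "k \<noteq> 2"
          then have "7\<^sup>2 \<le> (real (2 * k + 1))\<^sup>2" using k by (intro power_mono) auto
          then show False using tight(4) by simp
        qed
        moreover have "m * p = (card V - 2) div 2 * ((card V - 2 + 1) div 2)"
          using tight(3) unfolding half_prod_def of_nat_eq_iff by simp
        then have "{m, p} = {(card V - 2) div 2, (card V - 2 + 1) div 2}"
          by (rule prod_le_halves(2)[OF N])
        moreover have "card V - 2 + 1 = card V - 1" using n one ge by simp
        moreover have "\<forall>s. card (deepest s) = 1"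
          using one unfolding a_def b_def by (metis (full_types))
        ultimately show ?thesis
          using le_sq_radius[OF tight(1)] tight(2) by (simp add: m_def p_def)
      qed
    qed
  qed
qed

end

section \<open>Equality cases and conclusion\<close>

context balanced_bicentral
begin

lemma flip_classes:
  "balanced_bicentral.deepest V (\<lambda>u. \<not> side u) depth k s = deepest (\<not> s)"
  "balanced_bicentral.shallow V (\<lambda>u. \<not> side u) depth k s = shallow (\<not> s)"
  by (auto simp: balanced_bicentral.deepest_def[OF flip] balanced_bicentral.shallow_def[OF flip]
      deepest_def shallow_def)

end

lemma typed_3_least_eigenvalue:
  assumes wf: "pair_wf_digraph T" and typed: "typed T ty [1, 1, 1, n - 3, 0, 0, 0, 0]"
    and "n \<ge> 4" and vs: "distinct vs" "set vs = pverts T"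
  shows "least_eigenvalue (ecc_mat T vs) = - sqrt (larger_root (13 * real n - 35) (16 * (real n - 3)))"
proof -
  have "n - 3 \<ge> 1" using \<open>n \<ge> 4\<close> by simp
  obtain centre side depth where b: "balanced_bicentral (pverts T) (parcs T) centre side depth 1"
    "balanced_bicentral.spec_trace (pverts T) side depth 1 = 9 * real 1 * real (n - 3) + 4 * real 1 + 4 * real (n - 3)"
    "balanced_bicentral.spec_det (pverts T) side depth 1 = 16 * real 1 * real (n - 3)"
    by (rule typed_spectrum_3[OF wf typed order_refl \<open>n - 3 \<ge> 1\<close>])
  have "9 * real 1 * real (n - 3) + 4 * real 1 + 4 * real (n - 3) = 13 * real n - 35"
    "16 * real 1 * real (n - 3) = 16 * (real n - 3)"
    using \<open>n \<ge> 4\<close> by (simp_all add: of_nat_diff)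
  then show ?thesis
    using least_eigenvalue_ecc_mat[OF wf b(1) vs] b(2,3) by simp
qed

lemma typed_5_least_eigenvalue:
  assumes wf: "pair_wf_digraph T" and typed: "typed T ty [1, 1, (n - 6) div 2, (n - 5) div 2, 1, 1, 1, 1]"
    and "n \<ge> 6" and vs: "distinct vs" "set vs = pverts T"
  shows "least_eigenvalue (ecc_mat T vs) = - sqrt (larger_root (16 * real n - 21) (extremal_det n))"
proof -
  define a b where "a = real ((n - 6) div 2)" and "b = real ((n - 5) div 2)"
  obtain centre side depth where bb: "balanced_bicentral (pverts T) (parcs T) centre side depth 2"
    "balanced_bicentral.spec_trace (pverts T) side depth 2 = 75 + 16 * (a + b)"
    "balanced_bicentral.spec_det (pverts T) side depth 2 = (25 + 16 * a) * (25 + 16 * b)"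
    unfolding a_def b_def by (rule typed_spectrum_5[OF wf typed])
  have "75 + 16 * (a + b) = 16 * real n - 21 \<and> (25 + 16 * a) * (25 + 16 * b) = extremal_det n"
  proof (cases "even n")
    case True
    then obtain m where m: "n = 2 * m" by (elim evenE)
    then have "m \<ge> 3" "(n - 6) div 2 = m - 3" "(n - 5) div 2 = m - 3" using \<open>n \<ge> 6\<close> by auto
    then have ab: "a = real m - 3" "b = real m - 3" by (simp_all add: a_def b_def of_nat_diff)
    show ?thesis
      unfolding ab m extremal_det_def by (simp add: power2_eq_square algebra_simps)
  next
    case False
    then obtain m where m: "n = 2 * m + 1" by (elim oddE)
    then have "m \<ge> 3" "(n - 6) div 2 = m - 3" "(n - 5) div 2 = m - 2" using \<open>n \<ge> 6\<close> by auto
    then have ab: "a = real m - 3" "b = real m - 2" by (simp_all add: a_def b_def of_nat_diff)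
    show ?thesis
      unfolding ab m extremal_det_def by (simp add: power2_eq_square algebra_simps)
  qed
  then show ?thesis
    using least_eigenvalue_ecc_mat[OF wf bb(1) vs] unfolding bb(2,3) by (simp only:)
qed

lemma iso_path3_iff:
  assumes "pair_wf_digraph T" "n \<ge> 4"
  shows "digraph_iso (with_proj T) (with_proj (path_with_pendants 3 0 (n - 4)))
    \<longleftrightarrow> (\<exists>ty. typed T ty [1, 1, 1, n - 3, 0, 0, 0, 0])"
proof -
  have "n - 4 + 1 = n - 3" using assms(2) by simp
  then show ?thesis
    using typed_imp_iso[OF assms(1) wf_path_with_pendants _ typed_path3[of "n - 4"]]
      iso_imp_typed[OF assms(1) wf_path_with_pendants typed_path3[of "n - 4"]] by metis
qed

lemma iso_path5_iff:
  assumes "pair_wf_digraph T"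
  shows "digraph_iso (with_proj T) (with_proj (path_with_pendants 5 a b))
    \<longleftrightarrow> (\<exists>ty. typed T ty [1, 1, a, b, 1, 1, 1, 1])"
  using typed_imp_iso[OF assms wf_path_with_pendants _ typed_path5]
    iso_imp_typed[OF assms wf_path_with_pendants typed_path5] by metis

theorem theorem4p3:
  fixes T :: "'a pair_pre_digraph" and vs :: "'a list" and n :: nat and \<xi> :: real
  assumes tree: "simple_tree T"
    and order: "n = card (pverts T)" "n \<ge> 4"
    and odd_diameter: "odd (graph_diameter T)"
    and enumeration: "distinct vs" "set vs = pverts T"
    and xi: "\<xi> = least_eigenvalue (ecc_mat T vs)"
  shows "(n \<le> 15 \<longrightarrow>
      (let bound = - sqrt ((13 * real n - 35
                      + sqrt ((13 * real n - 35)\<^sup>2 - 64 * (real n - 3))) / 2)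
       in \<xi> \<le> bound
          \<and> (\<xi> = bound
               \<longleftrightarrow> digraph_iso (with_proj T) (with_proj (path_with_pendants 3 0 (n - 4))))))
    \<and> (n \<ge> 16 \<longrightarrow>
      (let bound = (if odd n
                    then - sqrt ((16 * real n - 21 + sqrt (800 * real n - 1419)) / 2)
                    else - sqrt ((16 * real n - 21 + 5 * sqrt (32 * real n - 67)) / 2))
       in \<xi> \<le> bound
          \<and> (\<xi> = bound
               \<longleftrightarrow> digraph_iso (with_proj T) (with_proj (path_with_pendants 5
                     (nat \<lfloor>(real n - 6) / 2\<rfloor>) (nat \<lceil>(real n - 6) / 2\<rceil>))))))"
proof -
  obtain k where k: "graph_diameter T = 2 * k + 1" using odd_diameter by (elim oddE)
  obtain centre side depth where
    bb: "balanced_bicentral (pverts T) (parcs T) centre side depth k"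
    using ex_tree_bicentral[OF tree k] by blast
  interpret balanced_bicentral "pverts T" "parcs T" centre side depth k by fact
  have wf: "pair_wf_digraph T"
    using tree by (simp add: simple_tree_def pair_graph_def pair_digraph_def pair_fin_digraph_def)
  have xi_eq: "\<xi> = - sqrt sq_radius"
    unfolding xi sq_radius_def by (rule least_eigenvalue_ecc_mat[OF wf bb enumeration])
  have "k > 0" by (rule k_pos) (use order in simp)
  have n_ge_6: "n \<ge> 6" if "k \<ge> 2"
    using card_V num_deepest_ge_1[of True] num_deepest_ge_1[of False]
      card_shallow_ge_2[OF that, of True] card_shallow_ge_2[OF that, of False] order(1) by linarith

  define small where "small = larger_root (13 * real n - 35) (16 * (real n - 3))"
  define large where "large = larger_root (16 * real n - 21) (extremal_det n)"
  have small: "small \<ge> 13 * real n - 37" "small\<^sup>2 - (13 * real n - 35) * small + 16 * (real n - 3) = 0"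
    unfolding small_def using larger_root_13_ge[of "real n"] order(2) by simp_all

  have small_case: "small \<le> sq_radius"
      "small = sq_radius \<Longrightarrow> \<exists>ty. typed T ty [1, 1, 1, n - 3, 0, 0, 0, 0]" if "n \<le> 15"
  proof -
    have "small < sq_radius \<or> small \<le> sq_radius \<and> k = 1 \<and> (num_deepest True = 1 \<or> num_deepest False = 1)"
    proof (cases "k = 1")
      case True
      then show ?thesis
        using compare_depth_1[OF True, of small] small order by auto
    next
      case False
      then have "k \<ge> 2" using \<open>k > 0\<close> by simp
      \<comment> \<open>The strict sign rules out equality for all trees with \<open>k\<close> at
        least 2.\<close>
      then have "extremal_poly (n - 2) small < 0"
        using extremal_poly_neg[OF n_ge_6 that small] by blast
      then show ?thesis
        using compare_depth_ge_2[OF \<open>k \<ge> 2\<close>, of small] small(1) order by auto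
    qed
    moreover have "\<exists>ty. typed T ty [1, 1, 1, n - 3, 0, 0, 0, 0]"
      if "k = 1" "num_deepest True = 1 \<or> num_deepest False = 1"
      using that(2)
    proof
      have n: "n = card (deepest True) + card (deepest False) + 2"
        using card_V sq_weight_depth_1(1)[OF that(1), of True]
          sq_weight_depth_1(1)[OF that(1), of False] order(1) unfolding num_deepest_def by linarith
      {
        assume "num_deepest True = 1"
        then have "card (deepest True) = 1" "card (deepest False) = n - 3"
          using n by (simp_all add: num_deepest_def)
        note this[unfolded that(1)]
        then show ?thesis using tree_typed_3[OF tree bb[unfolded that(1)]] by simp
      next
        assume "num_deepest False = 1"
        then have "card (deepest False) = 1" "card (deepest True) = n - 3"
          using n by (simp_all add: num_deepest_def)
        note this[unfolded that(1)]
        \<comment> \<open>The type list places the single leaf on the \<open>True\<close> side, so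
          the sides are exchanged.\<close>
        then show ?thesis
          using tree_typed_3[OF tree flip[unfolded that(1)]]
          unfolding flip_classes[unfolded that(1)] by simp
      }
    qed
    ultimately show "small \<le> sq_radius"
      "small = sq_radius \<Longrightarrow> \<exists>ty. typed T ty [1, 1, 1, n - 3, 0, 0, 0, 0]" by auto
  qed

  have large_case: "large \<le> sq_radius"
      "large = sq_radius \<Longrightarrow> \<exists>ty. typed T ty [1, 1, (n - 6) div 2, (n - 5) div 2, 1, 1, 1, 1]" if "n \<ge> 16"
  proof -
    note large = larger_root_16[OF that, folded large_def]
    have "large > 2" using large(1) that by simp
    have "large < sq_radius \<or> large \<le> sq_radius \<and> k = 2 \<and> (\<forall>s. card (deepest s) = 1) \<and>
      {card (shallow True), card (shallow False)} = {(n - 2) div 2, (n - 1) div 2}"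
    proof (cases "k = 1")
      case True
      then show ?thesis
        using compare_depth_1[OF True \<open>large > 2\<close>] large(3) order(1) by auto
    next
      case False
      then have "k \<ge> 2" using \<open>k > 0\<close> by simp
      moreover have "extremal_poly (n - 2) large = 0"
        using extremal_poly_eq[of n large] large(2) that by simp
      ultimately show ?thesis
        using compare_depth_ge_2[of large] \<open>large > 2\<close> order(1) by auto
    qed
    moreover have "\<exists>ty. typed T ty [1, 1, (n - 6) div 2, (n - 5) div 2, 1, 1, 1, 1]"
      if k2: "k = 2" and single: "\<And>s. card (deepest s) = 1"
        and sh: "{card (shallow True), card (shallow False)} = {(n - 2) div 2, (n - 1) div 2}"
    proof -
      \<comment> \<open>The 2 removed on each side are the centre and the parent of the deepest
        vertex; the rest are the pendants.\<close>
      have halves: "(n - 2) div 2 - 2 = (n - 6) div 2" "(n - 1) div 2 - 2 = (n - 5) div 2"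
        using \<open>n \<ge> 16\<close> by auto
      consider "card (shallow True) = (n - 2) div 2" "card (shallow False) = (n - 1) div 2"
        | "card (shallow False) = (n - 2) div 2" "card (shallow True) = (n - 1) div 2"
        using sh by (auto simp: doubleton_eq_iff)
      then show ?thesis
      proof cases
        case 1
        then show ?thesis
          using tree_typed_5[OF tree bb[unfolded k2] single[unfolded k2]] halves unfolding k2 by simp
      next
        case 2
        have "\<And>s. card (balanced_bicentral.deepest (pverts T) (\<lambda>u. \<not> side u) depth 2 s) = 1"
          unfolding flip_classes[unfolded k2] by (rule single[unfolded k2])
        then show ?thesis
          using tree_typed_5[OF tree flip[unfolded k2]] 2 halves
          unfolding flip_classes[unfolded k2] k2 by simp
      qed
    qed
    ultimately show "large \<le> sq_radius"
      "large = sq_radius \<Longrightarrow> \<exists>ty. typed T ty [1, 1, (n - 6) div 2, (n - 5) div 2, 1, 1, 1, 1]" by auto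
  qed

  have small_bound: "(13 * real n - 35 + sqrt ((13 * real n - 35)\<^sup>2 - 64 * (real n - 3))) / 2 = small"
    unfolding small_def larger_root_def by simp
  have large_bound: "(if odd n then - sqrt ((16 * real n - 21 + sqrt (800 * real n - 1419)) / 2)
      else - sqrt ((16 * real n - 21 + 5 * sqrt (32 * real n - 67)) / 2)) = - sqrt large"
  proof -
    \<comment> \<open>For even \<open>n\<close> the discriminant is \<open>800 * n - 1675\<close>,
      which contains the square 25; the odd case adds \<open>4 * 64 = 256\<close>.\<close>
    have five: "5 * sqrt (32 * real n - 67) = sqrt (25 * (32 * real n - 67))"
      unfolding real_sqrt_mult by simp
    have "(16 * real n - 21)\<^sup>2 - 4 * extremal_det n
        = (if odd n then 800 * real n - 1419 else 25 * (32 * real n - 67))"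
      by (simp add: extremal_det_def power2_eq_square algebra_simps)
    then show ?thesis
      unfolding five large_def larger_root_def by (cases "odd n") (simp_all only: not_False_eq_True not_True_eq_False if_True if_False)
  qed
  have floors: "nat \<lfloor>(real n - 6) / 2\<rfloor> = (n - 6) div 2" "nat \<lceil>(real n - 6) / 2\<rceil> = (n - 5) div 2"
    if "n \<ge> 16"
  proof -
    have "\<lfloor>(real n - 6) / 2\<rfloor> = int ((n - 6) div 2)"
      using that by (intro floor_unique) (auto simp: real_of_nat_div field_simps)
    then show "nat \<lfloor>(real n - 6) / 2\<rfloor> = (n - 6) div 2" by simp
    have "\<lceil>(real n - 6) / 2\<rceil> = int ((n - 5) div 2)"
      using that by (intro ceiling_unique) (cases "even n"; auto elim!: evenE oddE)+
    then show "nat \<lceil>(real n - 6) / 2\<rceil> = (n - 5) div 2" by simp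
  qed
  show ?thesis
    unfolding Let_def small_bound large_bound
  proof (intro conjI impI)
    assume n: "n \<le> 15"
    show "\<xi> \<le> - sqrt small" using small_case(1)[OF n] by (simp add: xi_eq)
    show "\<xi> = - sqrt small \<longleftrightarrow> digraph_iso (with_proj T) (with_proj (path_with_pendants 3 0 (n - 4)))"
      unfolding iso_path3_iff[OF wf order(2)]
      using small_case(2)[OF n] typed_3_least_eigenvalue[OF wf _ order(2) enumeration]
      by (auto simp: xi_eq xi[symmetric] small_def)
  next
    assume n: "n \<ge> 16"
    show "\<xi> \<le> - sqrt large" using large_case(1)[OF n] by (simp add: xi_eq)
    show "\<xi> = - sqrt large \<longleftrightarrow> digraph_iso (with_proj T) (with_proj (path_with_pendants 5
                     (nat \<lfloor>(real n - 6) / 2\<rfloor>) (nat \<lceil>(real n - 6) / 2\<rceil>)))"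
      unfolding floors[OF n] iso_path5_iff[OF wf]
      using large_case(2)[OF n] typed_5_least_eigenvalue[OF wf _ _ enumeration] n
      by (auto simp: xi_eq xi[symmetric] large_def)
  qed
qed

end
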